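(* Let $G$ be an $n$-vertex graph with $m$ edges. (a) If $G$ is $4$-colorable, then $\mathring{s}(G)\le\frac{8n+3m}{5}$ (in particular, $\mathring{s}(G)\le 3.4n$ when $G$ is planar). (b) If $G$ is outerplanar, then $\mathring{s}(G)\le\frac73 n$.
   Context: The slow-coloring game on a graph $G$: initially all vertices are uncolored. In each round, Lister marks a nonempty set $M$ of uncolored vertices and scores $|M|$; Painter then colors (with a new color) a subset $X\subseteq M$ that is independent in $G$. The game ends when all vertices are colored; the score is the sum of the sizes of all marked sets. Painter minimizes, Lister maximizes. The sum-color cost $\mathring{s}(G)$ is the score under optimal play by both players. *)

theory Defs
  imports "HOL-Analysis.Analysis"
begin

section \<open>Finite simple graphs\<close>

definition simple_graph :: "'a set \<Rightarrow> 'a set set \<Rightarrow> bool" where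
  "simple_graph V E \<longleftrightarrow> finite V \<and> (\<forall>e\<in>E. e \<subseteq> V \<and> card e = 2)"

definition independent_in :: "'a set set \<Rightarrow> 'a set \<Rightarrow> bool" where
  "independent_in E X \<longleftrightarrow> (\<forall>e\<in>E. \<not> e \<subseteq> X)"

definition colorable :: "nat \<Rightarrow> 'a set \<Rightarrow> 'a set set \<Rightarrow> bool" where
  "colorable k V E \<longleftrightarrow>
     (\<exists>c :: 'a \<Rightarrow> nat. (\<forall>v\<in>V. c v < k) \<and> (\<forall>u v. {u, v} \<in> E \<longrightarrow> c u \<noteq> c v))"


section \<open>Planar and outerplanar graphs\<close>

text \<open>Vertices are drawn as distinct points \<open>p v\<close> and edges as simple arcs \<open>\<gamma> e\<close> in the complex
  plane. An arc passes through no vertex other than its two ends, and two arcs meet only at the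
  images of common endpoints.\<close>

definition plane_drawing ::
    "'a set \<Rightarrow> 'a set set \<Rightarrow> ('a \<Rightarrow> complex) \<Rightarrow> ('a set \<Rightarrow> real \<Rightarrow> complex) \<Rightarrow> bool" where
  "plane_drawing V E p \<gamma> \<longleftrightarrow>
     inj_on p V \<and>
     (\<forall>e\<in>E. arc (\<gamma> e) \<and> {pathstart (\<gamma> e), pathfinish (\<gamma> e)} = p ` e \<and>
             path_image (\<gamma> e) \<inter> p ` V = p ` e) \<and>
     (\<forall>e\<in>E. \<forall>f\<in>E. e \<noteq> f \<longrightarrow> path_image (\<gamma> e) \<inter> path_image (\<gamma> f) = p ` (e \<inter> f))"

definition drawing_image ::
    "'a set \<Rightarrow> 'a set set \<Rightarrow> ('a \<Rightarrow> complex) \<Rightarrow> ('a set \<Rightarrow> real \<Rightarrow> complex) \<Rightarrow> complex set" where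
  "drawing_image V E p \<gamma> = p ` V \<union> (\<Union>e\<in>E. path_image (\<gamma> e))"

definition planar :: "'a set \<Rightarrow> 'a set set \<Rightarrow> bool" where
  "planar V E \<longleftrightarrow> (\<exists>p \<gamma>. plane_drawing V E p \<gamma>)"

text \<open>For a finite graph the image of a drawing is compact, so its \<^const>\<open>outside\<close> is the single
  unbounded face.\<close>

definition outerplanar :: "'a set \<Rightarrow> 'a set set \<Rightarrow> bool" where
  "outerplanar V E \<longleftrightarrow>
     (\<exists>p \<gamma>. plane_drawing V E p \<gamma> \<and> (\<forall>v\<in>V. p v \<in> frontier (outside (drawing_image V E p \<gamma>))))"


section \<open>The slow-coloring game\<close>

text \<open>A position is the set \<open>U\<close> of uncolored vertices. \<open>painter_guarantees E U k\<close>: from \<open>U\<close>, Painter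
  can force the game to end with a further score of at most \<open>k\<close>. Painter may answer with the empty
  set; such rounds leave the position unchanged, but the bound \<open>k\<close> drops by at least one each time,
  so plays that never end are never accepted.\<close>

inductive painter_guarantees :: "'a set set \<Rightarrow> 'a set \<Rightarrow> nat \<Rightarrow> bool" for E where
  finished: "painter_guarantees E {} k"
| round: "(\<And>M. M \<subseteq> U \<Longrightarrow> M \<noteq> {} \<Longrightarrow>
             card M \<le> k \<and>
             (\<exists>X\<subseteq>M. independent_in E X \<and> painter_guarantees E (U - X) (k - card M)))
           \<Longrightarrow> painter_guarantees E U k"

text \<open>\<open>lister_guarantees E U k\<close>: from \<open>U\<close>, Lister can force a further score of at least \<open>k\<close>. The
  natural-number subtraction is deliberately truncated: a score above \<open>k\<close> is good enough.\<close>

inductive lister_guarantees :: "'a set set \<Rightarrow> 'a set \<Rightarrow> nat \<Rightarrow> bool" for E where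
  nothing: "lister_guarantees E U 0"
| mark: "M \<subseteq> U \<Longrightarrow> M \<noteq> {} \<Longrightarrow>
         (\<And>X. X \<subseteq> M \<Longrightarrow> independent_in E X \<Longrightarrow> lister_guarantees E (U - X) (k - card M))
         \<Longrightarrow> lister_guarantees E U k"

text \<open>The value of the game; it exists and is unique by \<open>sum_color_cost_unique\<close> below.\<close>

definition sum_color_cost :: "'a set \<Rightarrow> 'a set set \<Rightarrow> nat" where
  "sum_color_cost V E = (THE k. painter_guarantees E V k \<and> lister_guarantees E V k)"

lemma painter_guarantees_mono:
  assumes "painter_guarantees E U k" "k \<le> l"
  shows "painter_guarantees E U l"
  using assms
proof (induction arbitrary: l rule: painter_guarantees.induct)
  case (finished k)
  then show ?case by (simp add: painter_guarantees.finished)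
next
  case (round U k)
  show ?case
  proof (rule painter_guarantees.round)
    fix M assume M: "M \<subseteq> U" "M \<noteq> {}"
    from round.IH[OF M] obtain X where X: "card M \<le> k" "X \<subseteq> M" "independent_in E X"
      "\<And>l. k - card M \<le> l \<Longrightarrow> painter_guarantees E (U - X) l" by blast
    have "painter_guarantees E (U - X) (l - card M)"
      using X(4) round.prems by (simp add: diff_le_mono)
    then show "card M \<le> l \<and>
        (\<exists>X\<subseteq>M. independent_in E X \<and> painter_guarantees E (U - X) (l - card M))"
      using X round.prems by auto
  qed
qed

lemma painter_guarantees_ex:
  assumes "finite U" "\<forall>e\<in>E. card e = 2"
  shows "painter_guarantees E U (card U * card U)"
  using assms(1)
proof (induction "card U" arbitrary: U)
  case 0
  then show ?case by (simp add: painter_guarantees.finished)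
next
  case (Suc n)
  show ?case
  proof (rule painter_guarantees.round)
    fix M assume M: "M \<subseteq> U" "M \<noteq> {}"
    then obtain v where v: "v \<in> M" by blast
    have cU': "card U = Suc n" using Suc.hyps(2) by simp
    have cM: "card M \<le> Suc n" using card_mono[OF Suc.prems M(1)] cU' by simp
    have "v \<in> U" using v M(1) by blast
    then have cU: "card (U - {v}) = n" using cU' Suc.prems by simp
    have "painter_guarantees E (U - {v}) (n * n)" using Suc.hyps(1)[of "U - {v}"] cU Suc.prems by simp
    then have P: "painter_guarantees E (U - {v}) (card U * card U - card M)"
    proof (rule painter_guarantees_mono)
      show "n * n \<le> card U * card U - card M" using cM by (simp add: cU')
    qed
    have "independent_in E {v}"
      unfolding independent_in_def
    proof
      fix e assume "e \<in> E"
      then have "card e = 2" using assms(2) by blast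
      then show "\<not> e \<subseteq> {v}" using card_mono[of "{v}" e] by auto
    qed
    moreover have "card M \<le> card U * card U" using cM by (simp add: cU')
    ultimately show "card M \<le> card U * card U \<and>
        (\<exists>X\<subseteq>M. independent_in E X \<and> painter_guarantees E (U - X) (card U * card U - card M))"
      using P v by blast
  qed
qed

lemma not_both_guarantee:
  assumes "painter_guarantees E U k" "k < l"
  shows "\<not> lister_guarantees E U l"
  using assms
proof (induction arbitrary: l rule: painter_guarantees.induct)
  case (finished k)
  show ?case
  proof
    assume "lister_guarantees E {} l"
    then show False
      by cases (use finished in auto)
  qed
next
  case (round U k)
  show ?case
  proof
    assume "lister_guarantees E U l"
    then show False
    proof cases
      case nothing
      then show False using round.prems by simp
    next
      case (mark M)
      from round.IH[OF mark(1,2)] obtain X where X: "card M \<le> k" "X \<subseteq> M" "independent_in E X"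
        "\<And>l. k - card M < l \<Longrightarrow> \<not> lister_guarantees E (U - X) l" by blast
      have "k - card M < l - card M" using X(1) round.prems by simp
      then show False using X mark(3) by blast
    qed
  qed
qed

lemma lister_guarantees_if_not_painter:
  assumes "finite U" "\<not> painter_guarantees E U k"
  shows "lister_guarantees E U (Suc k)"
  using assms
proof (induction k arbitrary: U rule: less_induct)
  case (less k)
  from less.prems(2) obtain M where M: "M \<subseteq> U" "M \<noteq> {}"
    "\<not> (card M \<le> k \<and>
        (\<exists>X\<subseteq>M. independent_in E X \<and> painter_guarantees E (U - X) (k - card M)))"
    using painter_guarantees.round[of U k E] by blast
  have "finite M" using M(1) less.prems(1) by (rule finite_subset)
  then have pos: "card M > 0" using M(2) by (simp add: card_gt_0_iff)
  show ?case
  proof (rule lister_guarantees.mark[OF M(1,2)])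
    fix X assume X: "X \<subseteq> M" "independent_in E X"
    show "lister_guarantees E (U - X) (Suc k - card M)"
    proof (cases "card M \<le> k")
      case True
      then have "\<not> painter_guarantees E (U - X) (k - card M)" using M(3) X by blast
      then show ?thesis
        using less.IH[of "k - card M" "U - X"] True pos less.prems(1) by (simp add: Suc_diff_le)
    next
      case False
      then show ?thesis by (simp add: lister_guarantees.nothing)
    qed
  qed
qed

lemma sum_color_cost_unique:
  assumes "simple_graph V E"
  shows "\<exists>!k. painter_guarantees E V k \<and> lister_guarantees E V k"
proof -
  have fin: "finite V" and E: "\<forall>e\<in>E. card e = 2"
    using assms by (auto simp: simple_graph_def)
  define k where "k = (LEAST k. painter_guarantees E V k)"
  have P: "painter_guarantees E V k"
    unfolding k_def using painter_guarantees_ex[OF fin E] by (rule LeastI)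
  have L: "lister_guarantees E V k"
  proof (cases k)
    case 0
    then show ?thesis by (simp add: lister_guarantees.nothing)
  next
    case (Suc j)
    then have "\<not> painter_guarantees E V j" using not_less_Least[of j "painter_guarantees E V"] by (simp add: k_def)
    then show ?thesis using lister_guarantees_if_not_painter[OF fin] Suc by blast
  qed
  show ?thesis
  proof (rule ex1I[of _ k])
    fix l assume l: "painter_guarantees E V l \<and> lister_guarantees E V l"
    have "\<not> k < l" using not_both_guarantee[OF P] l by blast
    moreover have "\<not> l < k" using not_both_guarantee L l by blast
    ultimately show "l = k" by simp
  qed (use P L in blast)
qed

end

theory Submission
  imports Defs
begin

text \<open>Painter follows a potential: if every marked set \<open>M\<close> contains an independent set whose removal
  decreases \<open>\<Phi>\<close> by at least \<open>d * card M\<close>, then the score is at most \<open>\<Phi> V / d\<close>.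

  If every clique \<open>Q\<close> contains a vertex with payment at least \<open>card Q - 1\<close>, then twice the number of
  vertices plus the number of edges plus all payments is such a potential with \<open>d = 2\<close>. Suitable
  payments come from a coloring with four colors, and for planar graphs from a coloring with five
  colors, since their cliques have at most four vertices. For a 3-coloring, three times the number of
  vertices plus the number of edges plus the number of colors that each vertex sees is a potential
  with \<open>d = 3\<close>; hence the bound \<open>(5 n + m) / 3\<close>.

  For planar and outerplanar graphs it remains to exclude the minors \<open>K\<^sub>5\<close> and \<open>K\<^sub>4\<close>. This bounds
  the number of edges (Mader's contraction argument) and yields the colorings. A drawn \<open>K\<^sub>5\<close> is impossible by
  a parity argument for winding numbers; in the outerplanar case, a point of the outer face is the
  fifth vertex.\<close>

subsection \<open>Potentials for Painter\<close>

text \<open>The clique condition comes from one deficit. With \<open>d = 2\<close>, a round must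
  earn two units per marked vertex. A colored vertex brings them through the vertex term; a marked
  vertex left over must bring them through its edges into the colored set \<open>X\<close>, and
  falls short by one when it has a single neighbour \<open>x\<close> there. For a well chosen
  \<open>X\<close> these short vertices form a clique together with \<open>x\<close>, and the
  payment of \<open>x\<close> covers them all. For planar graphs, a 4-coloring and m \<le> 3 n would
  give the constant 17/5, but at the price of the four color theorem. Five colors do as well,
  because payments can be capped at 3. Neither Euler's formula nor faces are used: edge bounds and
  colorings depend on excluded minors alone, and no drawing is ever contracted, since a minor is a
  family of connected vertex sets of the original graph.\<close>

lemma painter_guarantees_potential:
  fixes \<Phi> :: "'a set \<Rightarrow> nat"
  assumes "d > 0"
    and step: "\<And>U M. U \<subseteq> V \<Longrightarrow> M \<subseteq> U \<Longrightarrow>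
      \<exists>X\<subseteq>M. independent_in E X \<and> d * card M + \<Phi> (U - X) \<le> \<Phi> U"
    and "finite V" "U \<subseteq> V"
  shows "painter_guarantees E U (\<Phi> U div d)"
  using \<open>U \<subseteq> V\<close>
\<comment> \<open>The value of \<open>\<Phi>\<close> is the measure: \<open>M\<close> is nonempty
  and \<open>d > 0\<close>, so it drops strictly in every round.\<close>
proof (induction "\<Phi> U" arbitrary: U rule: less_induct)
  case less
  show ?case
  proof (rule painter_guarantees.round)
    fix M assume M: "M \<subseteq> U" "M \<noteq> {}"
    have "finite M" using M(1) less.prems \<open>finite V\<close> by (meson finite_subset)
    then have pos: "d * card M > 0" using M(2) \<open>d > 0\<close> by (simp add: card_gt_0_iff)
    obtain X where X: "X \<subseteq> M" "independent_in E X" "d * card M + \<Phi> (U - X) \<le> \<Phi> U"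
      using step[OF less.prems M(1)] by blast
    have "painter_guarantees E (U - X) (\<Phi> (U - X) div d)"
      using less.hyps[of "U - X"] X(3) pos less.prems by auto
    moreover have "\<Phi> (U - X) div d \<le> \<Phi> U div d - card M"
    proof -
      have "(d * card M + \<Phi> (U - X)) div d \<le> \<Phi> U div d" using X(3) by (rule div_le_mono)
      then show ?thesis using \<open>d > 0\<close> by simp
    qed
    ultimately have "painter_guarantees E (U - X) (\<Phi> U div d - card M)"
      by (rule painter_guarantees_mono)
    moreover have "card M \<le> \<Phi> U div d"
      using X(3) \<open>d > 0\<close> by (metis add_leD1 less_eq_div_iff_mult_less_eq mult.commute)
    ultimately show "card M \<le> \<Phi> U div d \<and>
        (\<exists>X\<subseteq>M. independent_in E X \<and> painter_guarantees E (U - X) (\<Phi> U div d - card M))"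
      using X by blast
  qed
qed

lemma sum_color_cost_le:
  assumes "simple_graph V E" "painter_guarantees E V k"
  shows "sum_color_cost V E \<le> k"
proof -
  have "lister_guarantees E V (sum_color_cost V E)"
    using theI'[OF sum_color_cost_unique[OF assms(1)]] by (simp add: sum_color_cost_def)
  then show ?thesis using not_both_guarantee[OF assms(2)] by (meson not_le)
qed

lemma sum_color_cost_le_potential:
  fixes \<Phi> :: "'a set \<Rightarrow> nat"
  assumes "simple_graph V E" "d > 0"
    and "\<And>U M. U \<subseteq> V \<Longrightarrow> M \<subseteq> U \<Longrightarrow>
      \<exists>X\<subseteq>M. independent_in E X \<and> d * card M + \<Phi> (U - X) \<le> \<Phi> U"
  shows "d * sum_color_cost V E \<le> \<Phi> V"
proof -
  have "sum_color_cost V E \<le> \<Phi> V div d"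
    using assms by (intro sum_color_cost_le painter_guarantees_potential) (auto simp: simple_graph_def)
  then show ?thesis
    using \<open>d > 0\<close> by (simp add: less_eq_div_iff_mult_less_eq mult.commute)
qed

subsection \<open>Neighbours and induced edges\<close>

definition nbrs :: "'a set set \<Rightarrow> 'a set \<Rightarrow> 'a \<Rightarrow> 'a set" where
  "nbrs E S v = {w\<in>S. {v, w} \<in> E}"

definition edges_in :: "'a set set \<Rightarrow> 'a set \<Rightarrow> 'a set set" where
  "edges_in E S = {e\<in>E. e \<subseteq> S}"

lemma finite_nbrs [simp]: "finite S \<Longrightarrow> finite (nbrs E S v)"
  by (simp add: nbrs_def)

lemma no_loop: "simple_graph V E \<Longrightarrow> {v} \<notin> E"
  by (auto simp: simple_graph_def)

lemma edge_neq: "simple_graph V E \<Longrightarrow> {v, w} \<in> E \<Longrightarrow> v \<noteq> w"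
  using no_loop by force

lemma edge_in: "simple_graph V E \<Longrightarrow> {v, w} \<in> E \<Longrightarrow> v \<in> V \<and> w \<in> V"
  by (auto simp: simple_graph_def)

lemma simple_graph_finite_E: "simple_graph V E \<Longrightarrow> finite E"
  by (rule finite_subset[of _ "Pow V"]) (auto simp: simple_graph_def)

lemma edges_in_V: "simple_graph V E \<Longrightarrow> edges_in E V = E"
  by (auto simp: edges_in_def simple_graph_def)

lemma independent_in_iff:
  assumes "simple_graph V E"
  shows "independent_in E X \<longleftrightarrow> (\<forall>x\<in>X. \<forall>y\<in>X. {x, y} \<notin> E)"
proof
  assume *: "\<forall>x\<in>X. \<forall>y\<in>X. {x, y} \<notin> E"
  show "independent_in E X" unfolding independent_in_def
  proof (intro ballI notI)
    fix e assume e: "e \<in> E" "e \<subseteq> X"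
    then have "card e = 2" using assms by (simp add: simple_graph_def)
    then obtain x y where "e = {x, y}" by (auto simp: card_2_iff)
    then show False using e * by auto
  qed
qed (auto simp: independent_in_def)

text \<open>An edge between \<open>X\<close> and \<open>U - X\<close> is counted once, at its end
  outside \<open>X\<close>. Edges inside \<open>X\<close> are discarded, hence only an
  inequality.\<close>

lemma edges_in_remove:
  assumes "simple_graph V E" "finite U" "X \<subseteq> U"
  shows "(\<Sum>v\<in>U - X. card (nbrs E X v)) + card (edges_in E (U - X)) \<le> card (edges_in E U)"
proof -
  have fE: "finite E" using assms(1) by (rule simple_graph_finite_E)
  have fX: "finite X" using \<open>finite U\<close> assms(3) finite_subset by blast
  let ?P = "Sigma (U - X) (nbrs E X)" and ?f = "\<lambda>(v, x). {v, x}"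
  have "inj_on ?f ?P" by (auto simp: inj_on_def nbrs_def doubleton_eq_iff)
  then have "card ?P = card (?f ` ?P)" by (simp add: card_image)
  moreover have "card ?P = (\<Sum>v\<in>U - X. card (nbrs E X v))"
    using \<open>finite U\<close> fX by (intro card_SigmaI) auto
  moreover have "card (?f ` ?P) + card (edges_in E (U - X)) = card (?f ` ?P \<union> edges_in E (U - X))"
    using fE \<open>finite U\<close> fX by (intro card_Un_disjoint[symmetric]) (auto simp: edges_in_def nbrs_def)
  moreover have "card (?f ` ?P \<union> edges_in E (U - X)) \<le> card (edges_in E U)"
    using fE assms(3) by (intro card_mono) (auto simp: edges_in_def nbrs_def)
  ultimately show ?thesis by simp
qed

subsection \<open>Payments bounding the clique sizes\<close>

lemma ex_max_if_finite_image:
  fixes f :: "'b \<Rightarrow> nat"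
  assumes "finite S" "S \<noteq> {}"
  shows "\<exists>X\<in>S. \<forall>Y\<in>S. f Y \<le> f X"
proof -
  have "Max (f ` S) \<in> f ` S" using assms by (intro Max_in) auto
  then obtain X where "X \<in> S" "f X = Max (f ` S)" by auto
  then show ?thesis using Max_ge[of "f ` S"] assms(1) by (intro bexI[of _ X]) auto
qed

lemma add_mod_inj:
  fixes x y :: nat
  assumes "(a + x) mod k = (a + y) mod k" "x < k" "y < k"
  shows "x = y"
proof -
  have "x = y" if "x \<le> y" "(a + y) mod k = (a + x) mod k" "y < k" for x y :: nat
    using that mod_eq_dvd_iff_nat[of "a + x" "a + y" k] by (auto dest: dvd_imp_le)
  then show ?thesis using assms by (metis nle_le)
qed

lemma obtain_best_independent:
  fixes p :: "'a \<Rightarrow> nat"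
  assumes "simple_graph V E" "finite M"
  obtains X where "X \<subseteq> M" "independent_in E X"
    "\<And>Y. Y \<subseteq> M \<Longrightarrow> independent_in E Y \<Longrightarrow> card Y \<le> card X"
    "\<And>Y. Y \<subseteq> M \<Longrightarrow> independent_in E Y \<Longrightarrow> card Y = card X \<Longrightarrow> sum p Y \<le> sum p X"
proof -
  let ?S = "{Y. Y \<subseteq> M \<and> independent_in E Y}"
  \<comment> \<open>A lexicographic order in one number: \<open>sum p Y\<close> stays below
    \<open>Suc (sum p M)\<close>, so a larger cardinality always wins and payments only break
    ties.\<close>
  let ?f = "\<lambda>Y. card Y * Suc (sum p M) + sum p Y"
  have "finite ?S" using assms by simp
  moreover have "{} \<in> ?S" using independent_in_iff[OF assms(1)] by simp
  ultimately obtain X where X: "X \<in> ?S" "\<And>Y. Y \<in> ?S \<Longrightarrow> ?f Y \<le> ?f X"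
    using ex_max_if_finite_image[of ?S ?f] by blast
  have "card Y \<le> card X" if "Y \<in> ?S" for Y
  proof (rule ccontr)
    assume "\<not> card Y \<le> card X"
    then have "Suc (card X) * Suc (sum p M) \<le> card Y * Suc (sum p M)" by (intro mult_le_mono1) simp
    moreover have "sum p X \<le> sum p M" using X(1) assms by (intro sum_mono2) auto
    ultimately show False using X(2)[OF that] by simp
  qed
  moreover have "sum p Y \<le> sum p X" if "Y \<in> ?S" "card Y = card X" for Y
    using X(2)[OF that(1)] that(2) by simp
  ultimately show ?thesis using that[of X] X(1) by simp
qed

text \<open>Painter colors a maximum independent subset of \<open>M\<close>, ties broken by total
  payment. Maximality gives every vertex of \<open>M - X\<close> a neighbour in \<open>X\<close> and
  makes those with \<open>x\<close> as their only one a clique; the tie-break makes the payment of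
  \<open>x\<close> the largest in that clique. The payments lost with \<open>X\<close> thus replace
  the missing second edges.\<close>

lemma pay_potential_step:
  fixes p :: "'a \<Rightarrow> nat"
  assumes G: "simple_graph V E"
    and pay: "\<And>Q. Q \<subseteq> V \<Longrightarrow> Q \<noteq> {} \<Longrightarrow> (\<And>u v. u \<in> Q \<Longrightarrow> v \<in> Q \<Longrightarrow> u \<noteq> v \<Longrightarrow> {u, v} \<in> E) \<Longrightarrow>
      \<exists>q\<in>Q. card Q \<le> Suc (p q)"
    and "U \<subseteq> V" "M \<subseteq> U"
  defines "\<Phi> \<equiv> \<lambda>S. 2 * card S + card (edges_in E S) + sum p S"
  shows "\<exists>X\<subseteq>M. independent_in E X \<and> 2 * card M + \<Phi> (U - X) \<le> \<Phi> U"
proof -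
  have fU: "finite U" using G \<open>U \<subseteq> V\<close> finite_subset by (auto simp: simple_graph_def)
  then have fM: "finite M" using \<open>M \<subseteq> U\<close> finite_subset by blast
  obtain X where X: "X \<subseteq> M" "independent_in E X"
    and maxX: "\<And>Y. Y \<subseteq> M \<Longrightarrow> independent_in E Y \<Longrightarrow> card Y \<le> card X"
    and bestX: "\<And>Y. Y \<subseteq> M \<Longrightarrow> independent_in E Y \<Longrightarrow> card Y = card X \<Longrightarrow> sum p Y \<le> sum p X"
    using obtain_best_independent[OF G fM] by blast
  note ind = independent_in_iff[OF G]
  have fX: "finite X" using X(1) fM finite_subset by blast
  have indX: "\<And>x y. x \<in> X \<Longrightarrow> y \<in> X \<Longrightarrow> {x, y} \<notin> E" using X(2) ind by blast
  define P where "P x = {v \<in> M - X. nbrs E X v = {x}}" for x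
  have fP: "finite (P x)" for x using fM by (simp add: P_def)
  have notP: "{v, y} \<notin> E" if "v \<in> P x" "y \<in> X - {x}" for v x y
    using that by (auto simp: P_def nbrs_def)
  have PX: "P x \<inter> X = {}" "P x \<subseteq> M" for x by (auto simp: P_def)
  \<comment> \<open>Two nonadjacent vertices of \<open>P x\<close> could replace \<open>x\<close>
    and enlarge \<open>X\<close>.\<close>
  have clique: "{y, z} \<in> E" if "x \<in> X" "y \<in> P x" "z \<in> P x" "y \<noteq> z" for x y z
  proof (rule ccontr)
    assume no: "{y, z} \<notin> E"
    let ?Y = "insert y (insert z (X - {x}))"
    have "independent_in E ?Y" unfolding ind
      using no indX notP[OF that(2)] notP[OF that(3)] no_loop[OF G]
      by (auto simp: insert_commute)
    moreover have "?Y \<subseteq> M" using that X(1) PX by blast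
    moreover have "y \<notin> X" "z \<notin> X" using that PX by blast+
    then have "card ?Y = Suc (Suc (card (X - {x})))" using that fX by simp
    then have "card ?Y = Suc (card X)" using card_Suc_Diff1[OF fX that(1)] by simp
    ultimately show False using maxX[of ?Y] by simp
  qed
  \<comment> \<open>Exchanging \<open>x\<close> for \<open>y\<close> keeps the size of
    \<open>X\<close>, so it cannot raise the total payment.\<close>
  have swap: "p y \<le> p x" if "x \<in> X" "y \<in> P x" for x y
  proof -
    let ?Y = "insert y (X - {x})"
    have "independent_in E ?Y" unfolding ind
      using indX notP[OF that(2)] no_loop[OF G] by (auto simp: insert_commute)
    moreover have "?Y \<subseteq> M" using that X(1) PX by blast
    moreover have "y \<notin> X" using that PX by blast
    then have "card ?Y = card X" using fX card_Suc_Diff1[OF fX that(1)] by simp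
    ultimately have "sum p ?Y \<le> sum p X" using bestX[of ?Y] by blast
    then show ?thesis using sum.remove[OF fX that(1), of p] fX \<open>y \<notin> X\<close> by simp
  qed
  have P_le: "card (P x) \<le> p x" if x: "x \<in> X" for x
  proof -
    let ?Q = "insert x (P x)"
    have "{x, y} \<in> E" if "y \<in> P x" for y
      using that by (auto simp: P_def nbrs_def insert_commute)
    then have "\<exists>q\<in>?Q. card ?Q \<le> Suc (p q)"
      using x X(1) PX(2)[of x] \<open>M \<subseteq> U\<close> \<open>U \<subseteq> V\<close> clique[OF x]
      by (intro pay) (auto simp: insert_commute)
    then obtain q where q: "q \<in> ?Q" "card ?Q \<le> Suc (p q)" by blast
    have "x \<notin> P x" using x PX by blast
    moreover have "p q \<le> p x" using q(1) swap[OF x] by auto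
    ultimately show ?thesis using q(2) fP by simp
  qed
  have ne: "nbrs E X v \<noteq> {}" if "v \<in> M - X" for v
  proof
    assume no: "nbrs E X v = {}"
    have "independent_in E (insert v X)" unfolding ind
      using no indX no_loop[OF G] by (auto simp: nbrs_def insert_commute)
    then have "card (insert v X) \<le> card X" using that X(1) by (intro maxX) auto
    then show False using that fX by simp
  qed
  have "2 * card (M - X) = (\<Sum>v\<in>M - X. 2)" by simp
  also have "\<dots> \<le> (\<Sum>v\<in>M - X. card (nbrs E X v) + (if card (nbrs E X v) = 1 then 1 else 0))"
  proof (rule sum_mono)
    fix v assume "v \<in> M - X"
    then have "card (nbrs E X v) > 0" using ne fX by (simp add: card_gt_0_iff)
    then show "2 \<le> card (nbrs E X v) + (if card (nbrs E X v) = 1 then 1 else 0)" by auto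
  qed
  also have "\<dots> = (\<Sum>v\<in>M - X. card (nbrs E X v)) + card {v \<in> M - X. card (nbrs E X v) = 1}"
    using fM by (simp add: sum.distrib sum.If_cases Int_def)
  also have "{v \<in> M - X. card (nbrs E X v) = 1} \<subseteq> (\<Union>x\<in>X. P x)"
  proof
    fix v assume v: "v \<in> {v \<in> M - X. card (nbrs E X v) = 1}"
    then obtain x where x: "nbrs E X v = {x}" by (auto simp: card_1_singleton_iff)
    then have "x \<in> X" by (auto simp: nbrs_def)
    then show "v \<in> (\<Union>x\<in>X. P x)" using v x by (auto simp: P_def)
  qed
  then have "card {v \<in> M - X. card (nbrs E X v) = 1} \<le> card (\<Union>x\<in>X. P x)"
    using fX fP by (intro card_mono) auto
  also have "\<dots> \<le> (\<Sum>x\<in>X. card (P x))" using fX by (rule card_UN_le)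
  also have "\<dots> \<le> sum p X" using P_le by (rule sum_mono)
  also have "(\<Sum>v\<in>M - X. card (nbrs E X v)) \<le> (\<Sum>v\<in>U - X. card (nbrs E X v))"
    using fU \<open>M \<subseteq> U\<close> by (intro sum_mono2) auto
  finally have "2 * card (M - X) \<le> (\<Sum>v\<in>U - X. card (nbrs E X v)) + sum p X" by simp
  moreover have "X \<subseteq> U" using X(1) \<open>M \<subseteq> U\<close> by blast
  moreover have "card (M - X) + card X = card M" using X(1) fM fX by (metis card_Diff_subset card_mono le_add_diff_inverse2)
  moreover have "card (U - X) + card X = card U"
    using \<open>X \<subseteq> U\<close> fU fX by (metis card_Diff_subset card_mono le_add_diff_inverse2)
  moreover have "sum p (U - X) + sum p X = sum p U"
    using \<open>X \<subseteq> U\<close> fU by (metis sum.subset_diff)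
  ultimately have "2 * card M + \<Phi> (U - X) \<le> \<Phi> U"
    using edges_in_remove[OF G fU, of X] by (simp add: \<Phi>_def)
  then show ?thesis using X by blast
qed

lemma sum_color_cost_le_pay:
  fixes p :: "'a \<Rightarrow> nat"
  assumes "simple_graph V E"
    and "\<And>Q. Q \<subseteq> V \<Longrightarrow> Q \<noteq> {} \<Longrightarrow> (\<And>u v. u \<in> Q \<Longrightarrow> v \<in> Q \<Longrightarrow> u \<noteq> v \<Longrightarrow> {u, v} \<in> E) \<Longrightarrow>
      \<exists>q\<in>Q. card Q \<le> Suc (p q)"
  shows "2 * sum_color_cost V E \<le> 2 * card V + card E + sum p V"
proof -
  let ?\<Phi> = "\<lambda>S. 2 * card S + card (edges_in E S) + sum p S"
  have "2 * sum_color_cost V E \<le> ?\<Phi> V"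
  proof (rule sum_color_cost_le_potential[OF assms(1)])
    fix U M assume "U \<subseteq> V" "M \<subseteq> U"
    then show "\<exists>X\<subseteq>M. independent_in E X \<and> 2 * card M + ?\<Phi> (U - X) \<le> ?\<Phi> U"
      using pay_potential_step[of V E p U M, OF assms] by blast
  qed simp
  then show ?thesis by (simp add: edges_in_V[OF assms(1)])
qed

text \<open>Each rotation \<open>r\<close> of the colors yields the payments \<open>min t ((c v + r) mod k)\<close>; some rotation
  pays at most the average.\<close>

lemma sum_color_cost_le_rotated_pay:
  assumes G: "simple_graph V E" and "colorable k V E"
    and small: "\<And>Q. Q \<subseteq> V \<Longrightarrow> (\<And>u v. u \<in> Q \<Longrightarrow> v \<in> Q \<Longrightarrow> u \<noteq> v \<Longrightarrow> {u, v} \<in> E) \<Longrightarrow> card Q \<le> Suc t"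
  shows "k * (2 * sum_color_cost V E) \<le> k * (2 * card V + card E) + (\<Sum>i<k. min t i) * card V"
proof -
  obtain c where c: "\<And>v. v \<in> V \<Longrightarrow> c v < k" "\<And>u v. {u, v} \<in> E \<Longrightarrow> c u \<noteq> c v"
    using assms(2) by (auto simp: colorable_def)
  have fV: "finite V" using G by (simp add: simple_graph_def)
  define p where "p r v = min t ((c v + r) mod k)" for r v
  \<comment> \<open>Over all rotations each vertex takes every color once, so its payments add up to
    the sum of \<open>min t i\<close> over \<open>i < k\<close>.\<close>
  have rot: "bij_betw (\<lambda>r. (a + r) mod k) {..<k} {..<k}" for a
  proof -
    have "inj_on (\<lambda>r. (a + r) mod k) {..<k}"
    proof (rule inj_onI)
      fix x y assume "x \<in> {..<k}" "y \<in> {..<k}" "(a + x) mod k = (a + y) mod k"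
      then show "x = y" using add_mod_inj[of a x k y] by simp
    qed
    moreover have "(\<lambda>r. (a + r) mod k) ` {..<k} \<subseteq> {..<k}" by auto
    ultimately show ?thesis by (simp add: bij_betw_def endo_inj_surj)
  qed
  have "2 * sum_color_cost V E \<le> 2 * card V + card E + sum (p r) V" if "r < k" for r
  proof (rule sum_color_cost_le_pay[OF G])
    fix Q assume Q: "Q \<subseteq> V" "Q \<noteq> {}" "\<And>u v. u \<in> Q \<Longrightarrow> v \<in> Q \<Longrightarrow> u \<noteq> v \<Longrightarrow> {u, v} \<in> E"
    have fQ: "finite Q" using Q(1) fV finite_subset by blast
    let ?g = "\<lambda>v. (c v + r) mod k"
    have "inj_on ?g Q"
    proof (rule inj_onI)
      fix u v assume uv: "u \<in> Q" "v \<in> Q" "?g u = ?g v"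
      then have "c u = c v" using add_mod_inj[of r "c u" k "c v"] c(1) Q(1) by (auto simp: add.commute)
      then show "u = v" using c(2) Q(3) uv by blast
    qed
    \<comment> \<open>Distinct colors on \<open>Q\<close> force the largest one to be at least
      \<open>card Q - 1\<close>; the cap \<open>t\<close> does no harm since
      \<open>card Q \<le> Suc t\<close>.\<close>
    then have "card Q = card (?g ` Q)" by (simp add: card_image)
    also have "\<dots> \<le> card {..Max (?g ` Q)}" using fQ by (intro card_mono) auto
    finally have "card Q \<le> Suc (Max (?g ` Q))" by simp
    moreover have "Max (?g ` Q) \<in> ?g ` Q" using fQ Q(2) by (intro Max_in) auto
    then obtain q where "q \<in> Q" "Max (?g ` Q) = ?g q" by blast
    moreover have "card Q \<le> Suc t" using small[OF Q(1,3)] .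
    ultimately show "\<exists>q\<in>Q. card Q \<le> Suc (p r q)" by (auto simp: p_def min_def)
  qed
  then have "(\<Sum>r<k. 2 * sum_color_cost V E) \<le> (\<Sum>r<k. 2 * card V + card E + sum (p r) V)"
    by (intro sum_mono) simp
  also have "\<dots> = k * (2 * card V + card E) + (\<Sum>v\<in>V. \<Sum>r<k. p r v)"
    by (subst sum.swap) (simp add: sum.distrib)
  also have "(\<Sum>v\<in>V. \<Sum>r<k. p r v) = (\<Sum>v\<in>V. \<Sum>i<k. min t i)"
    unfolding p_def using sum.reindex_bij_betw[OF rot, where g = "min t"] by simp
  finally show ?thesis by (simp add: algebra_simps)
qed

text \<open>The coloring orients the edges: a vertex is paid for each neighbour of lower color. All
  payments together count an edge at most once, and in a clique the vertex of highest color is paid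
  for all the others.\<close>

lemma sum_color_cost_le_card_add_edges:
  assumes G: "simple_graph V E" and "colorable k V E"
  shows "sum_color_cost V E \<le> card V + card E"
proof -
  obtain c where c: "\<And>u v. {u, v} \<in> E \<Longrightarrow> c u \<noteq> (c v :: nat)"
    using assms(2) by (auto simp: colorable_def)
  have fV: "finite V" using G by (simp add: simple_graph_def)
  define low where "low v = {u \<in> V. {u, v} \<in> E \<and> c u < c v}" for v
  have fl: "finite (low v)" for v using fV by (simp add: low_def)
  have "2 * sum_color_cost V E \<le> 2 * card V + card E + (\<Sum>v\<in>V. card (low v))"
  proof (rule sum_color_cost_le_pay[OF G])
    fix Q assume Q: "Q \<subseteq> V" "Q \<noteq> {}" "\<And>u v. u \<in> Q \<Longrightarrow> v \<in> Q \<Longrightarrow> u \<noteq> v \<Longrightarrow> {u, v} \<in> E"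
    have fQ: "finite Q" using Q(1) fV finite_subset by blast
    then have "Max (c ` Q) \<in> c ` Q" using Q(2) by (intro Max_in) auto
    then obtain q where q: "q \<in> Q" "Max (c ` Q) = c q" by auto
    have "Q - {q} \<subseteq> low q"
    proof
      fix u assume u: "u \<in> Q - {q}"
      then have "{u, q} \<in> E" using Q(3) q(1) by blast
      moreover have "c u \<le> c q" using Max_ge[of "c ` Q" "c u"] q(2) fQ u by auto
      ultimately show "u \<in> low q" using c[of u q] u Q(1) by (auto simp: low_def)
    qed
    then have "card (Q - {q}) \<le> card (low q)" using fl by (rule card_mono[rotated])
    then show "\<exists>q\<in>Q. card Q \<le> Suc (card (low q))" using q(1) fQ by (intro bexI[of _ q]) auto
  qed
  moreover have "(\<Sum>v\<in>V. card (low v)) \<le> card E"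
  proof -
    let ?f = "\<lambda>(v, u). {u, v}"
    have "inj_on ?f (Sigma V low)" by (auto simp: inj_on_def low_def doubleton_eq_iff)
    then have "card (Sigma V low) = card (?f ` Sigma V low)" by (simp add: card_image)
    also have "\<dots> \<le> card E"
      using simple_graph_finite_E[OF G] by (intro card_mono) (auto simp: low_def)
    finally show ?thesis using fV fl by simp
  qed
  ultimately show ?thesis by simp
qed

text \<open>The rotated payments sum to 0 + 1 + 2 + 3 = 6, so 8 s \<le> 14 n + 4 m. Halving this and
  adding s \<le> n + m gives 5 s \<le> 8 n + 3 m.\<close>

theorem sum_color_cost_four_colorable:
  assumes "simple_graph V E" "colorable 4 V E"
  shows "5 * sum_color_cost V E \<le> 8 * card V + 3 * card E"
proof -
  have "card Q \<le> Suc 3" if "Q \<subseteq> V" "\<And>u v. u \<in> Q \<Longrightarrow> v \<in> Q \<Longrightarrow> u \<noteq> v \<Longrightarrow> {u, v} \<in> E" for Q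
  proof -
    obtain c where c: "\<And>v. v \<in> V \<Longrightarrow> c v < 4" "\<And>u v. {u, v} \<in> E \<Longrightarrow> c u \<noteq> (c v :: nat)"
      using assms(2) by (auto simp: colorable_def)
    have "inj_on c Q" using c(2) that(2) by (meson inj_onI)
    moreover have "c ` Q \<subseteq> {..<4}" using c(1) that(1) by auto
    ultimately show ?thesis using card_inj_on_le[of c Q "{..<4}"] by simp
  qed
  from sum_color_cost_le_rotated_pay[OF assms this]
  have "4 * (2 * sum_color_cost V E) \<le> 4 * (2 * card V + card E) + 6 * card V"
    by (simp add: numeral_eq_Suc)
  then show ?thesis using sum_color_cost_le_card_add_edges[OF assms] by simp
qed

subsection \<open>Three-colored graphs\<close>

text \<open>One of the six orders of the color classes makes the greedy answer good enough, because the
  average over them is.\<close>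

definition greedy_first :: "'a set set \<Rightarrow> ('a \<Rightarrow> nat) \<Rightarrow> 'a set \<Rightarrow> nat \<Rightarrow> nat \<Rightarrow> 'a set" where
  "greedy_first E c M p q =
     {v\<in>M. c v = p} \<union> {v\<in>M. c v = q \<and> nbrs E {w\<in>M. c w = p} v = {}}"

definition greedy :: "'a set set \<Rightarrow> ('a \<Rightarrow> nat) \<Rightarrow> 'a set \<Rightarrow> nat \<Rightarrow> nat \<Rightarrow> nat \<Rightarrow> 'a set" where
  "greedy E c M p q r =
     greedy_first E c M p q \<union> {v\<in>M. c v = r \<and> nbrs E (greedy_first E c M p q) v = {}}"

definition seen :: "'a set set \<Rightarrow> ('a \<Rightarrow> nat) \<Rightarrow> 'a set \<Rightarrow> 'a \<Rightarrow> nat" where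
  "seen E c S v = card (c ` nbrs E S v)"

text \<open>The share of the marked vertex \<open>v\<close> in the drop of the potential minus three times the score;
  an edge between a colored and an uncolored vertex is credited to the marked and uncolored end, or
  else to the colored end.\<close>

definition share :: "'a set set \<Rightarrow> ('a \<Rightarrow> nat) \<Rightarrow> 'a set \<Rightarrow> 'a set \<Rightarrow> 'a set \<Rightarrow> 'a \<Rightarrow> int" where
  "share E c U M X v =
     (if v \<in> X then int (seen E c U v) + int (card (nbrs E (U - M) v))
      else int (card (nbrs E X v)) + int (seen E c U v) - int (seen E c (U - X) v) - 3)"

lemma greedy_subset: "greedy E c M p q r \<subseteq> M"
  by (auto simp: greedy_def greedy_first_def)

lemma independent_greedy:
  assumes "simple_graph V E" and proper: "\<And>u v. {u, v} \<in> E \<Longrightarrow> c u \<noteq> c v"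
  shows "independent_in E (greedy E c M p q r)"
  unfolding independent_in_iff[OF assms(1)]
proof (intro ballI notI)
  fix x y assume xy: "x \<in> greedy E c M p q r" "y \<in> greedy E c M p q r" "{x, y} \<in> E"
  have "{y, x} \<in> E" using xy(3) by (simp add: insert_commute)
  then show False
    using xy proper[OF xy(3)] by (auto simp: greedy_def greedy_first_def nbrs_def)
qed

text \<open>The vertex term falls by 3 for colored vertices only, which leaves the
  \<open>- 3\<close> in the share of each vertex of \<open>M - X\<close>. Double counting moves the
  edges from \<open>X\<close> to \<open>U - M\<close> to their colored ends. Vertices of
  \<open>U - M\<close> can only lose seen colors, so dropping that gain keeps the
  inequality.\<close>

lemma sum_share_le:
  fixes c :: "'a \<Rightarrow> nat"
  assumes G: "simple_graph V E" and "finite U" "M \<subseteq> U" "X \<subseteq> M"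
  defines "\<Phi> \<equiv> \<lambda>S. 3 * card S + card (edges_in E S) + (\<Sum>v\<in>S. seen E c S v)"
  shows "(\<Sum>v\<in>M. share E c U M X v) \<le> int (\<Phi> U) - int (\<Phi> (U - X)) - 3 * int (card M)"
proof -
  have "X \<subseteq> U" using \<open>X \<subseteq> M\<close> \<open>M \<subseteq> U\<close> by blast
  then have fin: "finite M" "finite X" "finite (U - M)"
    using finite_subset[OF _ \<open>finite U\<close>] \<open>M \<subseteq> U\<close> by auto
  have mono: "seen E c S v \<le> seen E c T v" if "S \<subseteq> T" "T \<subseteq> U" for S T v
    unfolding seen_def using that \<open>finite U\<close>
    by (intro card_mono finite_imageI finite_nbrs image_mono) (auto simp: nbrs_def intro: finite_subset)
  have swap: "(\<Sum>x\<in>X. card (nbrs E (U - M) x)) = (\<Sum>v\<in>U - M. card (nbrs E X v))"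
  proof -
    have "(\<Sum>x\<in>X. \<Sum>v\<in>U - M. of_bool ({x, v} \<in> E)) = (\<Sum>v\<in>U - M. \<Sum>x\<in>X. of_bool ({x, v} \<in> E) :: nat)"
      by (rule sum.swap)
    then show ?thesis using fin
      by (simp add: nbrs_def of_bool_def sum.If_cases Int_def insert_commute)
  qed
  have M: "M = X \<union> (M - X)" "X \<inter> (M - X) = {}" using \<open>X \<subseteq> M\<close> by blast+
  have U: "U - X = (M - X) \<union> (U - M)" "(M - X) \<inter> (U - M) = {}" using \<open>X \<subseteq> M\<close> \<open>M \<subseteq> U\<close> by blast+
  have "(\<Sum>v\<in>M. share E c U M X v) = (\<Sum>v\<in>X. share E c U M X v) + (\<Sum>v\<in>M - X. share E c U M X v)"
    using fin by (subst M(1), subst sum.union_disjoint) auto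
  also have "\<dots> = (\<Sum>v\<in>X. int (seen E c U v)) + (\<Sum>v\<in>X. int (card (nbrs E (U - M) v)))
     + (\<Sum>v\<in>M - X. int (card (nbrs E X v))) + (\<Sum>v\<in>M - X. int (seen E c U v) - int (seen E c (U - X) v))
     - 3 * int (card (M - X))"
    by (simp add: share_def sum.distrib sum_subtractf)
  also have "(\<Sum>v\<in>M - X. int (seen E c U v) - int (seen E c (U - X) v))
     \<le> (\<Sum>v\<in>U - X. int (seen E c U v) - int (seen E c (U - X) v))"
    using \<open>finite U\<close> \<open>M \<subseteq> U\<close> mono by (intro sum_mono2) auto
  also have "\<dots> = (\<Sum>v\<in>U. int (seen E c U v)) - (\<Sum>v\<in>X. int (seen E c U v)) - (\<Sum>v\<in>U - X. int (seen E c (U - X) v))"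
    using \<open>X \<subseteq> U\<close> \<open>finite U\<close> by (simp add: sum_subtractf sum_diff)
  also have "(\<Sum>v\<in>X. int (card (nbrs E (U - M) v))) = (\<Sum>v\<in>U - M. int (card (nbrs E X v)))"
    using swap by (metis of_nat_sum)
  finally have "(\<Sum>v\<in>M. share E c U M X v) \<le> ((\<Sum>v\<in>U - M. int (card (nbrs E X v))) + (\<Sum>v\<in>M - X. int (card (nbrs E X v))))
     + (\<Sum>v\<in>U. int (seen E c U v)) - (\<Sum>v\<in>U - X. int (seen E c (U - X) v)) - 3 * int (card (M - X))"
    by simp
  also have "(\<Sum>v\<in>U - M. int (card (nbrs E X v))) + (\<Sum>v\<in>M - X. int (card (nbrs E X v))) = (\<Sum>v\<in>U - X. int (card (nbrs E X v)))"
    using fin by (subst U(1), subst sum.union_disjoint) auto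
  also have "\<dots> \<le> int (card (edges_in E U)) - int (card (edges_in E (U - X)))"
    using edges_in_remove[OF G \<open>finite U\<close> \<open>X \<subseteq> U\<close>] by (simp flip: of_nat_sum of_nat_add)
  moreover have "int (card (M - X)) = int (card M) - int (card X)" "int (card (U - X)) = int (card U) - int (card X)"
    using fin \<open>finite U\<close> \<open>X \<subseteq> M\<close> \<open>X \<subseteq> U\<close> by (auto simp: card_Diff_subset card_mono of_nat_diff)
  ultimately show ?thesis by (simp add: \<Phi>_def)
qed

lemma nbr_color:
  fixes c :: "'a \<Rightarrow> nat"
  assumes "\<And>u v. {u, v} \<in> E \<Longrightarrow> c u \<noteq> c v" "\<And>w. w \<in> U \<Longrightarrow> c w \<in> {g, a, b}" "c v = g"
    and "w \<in> nbrs E U v"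
  shows "c w = a \<or> c w = b"
  using assms by (fastforce simp: nbrs_def)

text \<open>An order that colors \<open>v\<close> earns its seen colors plus its unmarked
  neighbours. An order that does not costs at most 2, because some neighbour of \<open>v\<close> was
  colored instead, and at most 1 if the color of that neighbour thereby goes out of sight. The cases
  are whether \<open>a\<close> and \<open>b\<close> occur among the marked neighbours of
  \<open>v\<close>.\<close>

lemma sum_orders_share_nonneg:
  fixes c :: "'a \<Rightarrow> nat"
  assumes G: "simple_graph V E" and "finite U" "M \<subseteq> U" "v \<in> M"
    and proper: "\<And>u v. {u, v} \<in> E \<Longrightarrow> c u \<noteq> c v"
    and cols: "\<And>w. w \<in> U \<Longrightarrow> c w \<in> {g, a, b}"
    and dist: "g \<noteq> a" "g \<noteq> b" "a \<noteq> b" and "c v = g"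
  defines "K \<equiv> \<lambda>p q r. share E c U M (greedy E c M p q r) v"
  shows "0 \<le> K g a b + K g b a + K a g b + K b g a + K a b g + K b a g"
proof -
  define cl where "cl S x = {w \<in> nbrs E S v. c w = x}" for S x
  define n where "n S x = card (cl S x)" for S x
  have fcl: "finite (cl S x)" if "S \<subseteq> U" for S x
    using finite_subset[OF that \<open>finite U\<close>] by (simp add: cl_def)
  have nbc: "c w = a \<or> c w = b" if "w \<in> nbrs E S v" "S \<subseteq> U" for w S
    using nbr_color[of E c U g a b v w] proper cols \<open>c v = g\<close> that by (auto simp: nbrs_def)
  have nb: "nbrs E S v = cl S a \<union> cl S b" "cl S a \<inter> cl S b = {}" if "S \<subseteq> U" for S
    using nbc[OF _ that] dist(3) by (auto simp: cl_def)
  have card_nb: "card (nbrs E S v) = n S a + n S b" if "S \<subseteq> U" for S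
    unfolding n_def using nb[OF that] fcl[OF that] by (simp add: card_Un_disjoint)
  have seen: "seen E c S v = of_bool (n S a > 0) + of_bool (n S b > 0)" if "S \<subseteq> U" for S
  proof -
    have "c ` nbrs E S v = (if cl S a = {} then {} else {a}) \<union> (if cl S b = {} then {} else {b})"
      using nb[OF that] by (auto simp: cl_def)
    then show ?thesis
      unfolding seen_def n_def using dist(3) fcl[OF that] by (simp add: card_gt_0_iff)
  qed
  have n_split: "n U x = n M x + n (U - M) x" for x
  proof -
    have "cl U x = cl M x \<union> cl (U - M) x" using \<open>M \<subseteq> U\<close> by (auto simp: cl_def nbrs_def)
    moreover have "cl M x \<inter> cl (U - M) x = {}" by (auto simp: cl_def nbrs_def)
    ultimately show ?thesis using fcl \<open>M \<subseteq> U\<close> by (simp add: n_def card_Un_disjoint)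
  qed
  have n_diff: "n (U - X) x + n X x = n U x" if "X \<subseteq> U" for X x
  proof -
    have "cl U x = cl (U - X) x \<union> cl X x" using that by (auto simp: cl_def nbrs_def)
    moreover have "cl (U - X) x \<inter> cl X x = {}" by (auto simp: cl_def nbrs_def)
    ultimately show ?thesis using fcl that by (simp add: n_def card_Un_disjoint)
  qed
  let ?s = "of_bool (n U a > 0) + of_bool (n U b > 0) :: int"
  let ?un = "int (n (U - M) a) + int (n (U - M) b)"
  have in_X: "share E c U M X v = ?s + ?un" if "v \<in> X" for X
    using that card_nb[of "U - M"] seen[of U] by (simp add: share_def)
  have out_X: "share E c U M X v = int (n X a) + int (n X b) + ?s
      - of_bool (n (U - X) a > 0) - of_bool (n (U - X) b > 0) - 3" if "v \<notin> X" "X \<subseteq> M" for X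
    using that \<open>M \<subseteq> U\<close> card_nb[of X] seen[of U] seen[of "U - X"] by (simp add: share_def)
  have first: "K g x y = ?s + ?un" for x y
    unfolding K_def using \<open>c v = g\<close> \<open>v \<in> M\<close> by (intro in_X) (auto simp: greedy_def greedy_first_def)
  have n0: "n M x = 0 \<longleftrightarrow> nbrs E {w\<in>M. c w = x} v = {}" for x
    using fcl[OF \<open>M \<subseteq> U\<close>] by (auto simp: n_def cl_def nbrs_def)
  have n_le: "n X x \<le> n M x" if "X \<subseteq> M" for X x
    unfolding n_def using that \<open>M \<subseteq> U\<close> fcl[of M] by (intro card_mono) (auto simp: cl_def nbrs_def)
  have early: "n (greedy E c M x y z) x = n M x" for x y z
  proof -
    have "cl (greedy E c M x y z) x = cl M x" by (auto simp: cl_def nbrs_def greedy_def greedy_first_def)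
    then show ?thesis by (simp add: n_def)
  qed
  have out_bound: "share E c U M X v \<ge> int (n X x) + of_bool (n U x > 0 \<and> n (U - X) x = 0) - 3"
    if "v \<notin> X" "X \<subseteq> M" "x \<in> {a, b}" for X x
    using out_X[OF that(1,2)] that(3) n_diff[of X a] n_diff[of X b] subset_trans[OF that(2) \<open>M \<subseteq> U\<close>]
    by (auto simp: of_bool_def split: if_splits)
  \<comment> \<open>The first color class is colored entirely: \<open>v\<close> gets credit for all
    its marked neighbours of color \<open>x\<close>, and stops seeing \<open>x\<close> unless an
    unmarked one remains.\<close>
  have hit: "K x y z \<ge> int (n M x) + of_bool (n (U - M) x = 0) - 3"
    if "x \<in> {a, b}" "n M x > 0" for x y z
  proof -
    let ?X = "greedy E c M x y z"
    have "v \<notin> ?X"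
      using that n0[of x] \<open>c v = g\<close> dist by (auto simp: greedy_def greedy_first_def nbrs_def)
    from out_bound[OF this greedy_subset that(1)] show ?thesis
      using that(2) early[of x y z] n_split[of x] n_diff[of ?X x] subset_trans[OF greedy_subset \<open>M \<subseteq> U\<close>]
      unfolding K_def by (auto simp: of_bool_def split: if_splits)
  qed
  have second: "K x g y = ?s + ?un" if "n M x = 0" "x \<noteq> g" for x y
    unfolding K_def using that n0[of x] \<open>c v = g\<close> \<open>v \<in> M\<close>
    by (intro in_X) (auto simp: greedy_def greedy_first_def)
  have third: "K x y g \<ge> min (?s + ?un) (of_bool (n M y = 1 \<and> n (U - M) y = 0) - 2)"
    if "n M x = 0" "y \<in> {a, b}" "x \<in> {a, b}" "x \<noteq> y" for x y
  proof (cases "v \<in> greedy E c M x y g")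
    case True
    then show ?thesis using in_X[OF True] unfolding K_def by simp
  next
    case False
    let ?X = "greedy E c M x y g"
    have "nbrs E (greedy_first E c M x y) v \<noteq> {}"
      using False \<open>c v = g\<close> \<open>v \<in> M\<close> by (auto simp: greedy_def)
    then obtain w where w: "w \<in> greedy_first E c M x y" "{v, w} \<in> E" by (auto simp: nbrs_def)
    have "c w \<noteq> x" using n0[of x] that(1) w by (auto simp: nbrs_def greedy_first_def)
    then have "w \<in> cl ?X y" using w by (auto simp: cl_def nbrs_def greedy_def greedy_first_def)
    moreover have "?X \<subseteq> U" using subset_trans[OF greedy_subset \<open>M \<subseteq> U\<close>] .
    ultimately have "n ?X y \<ge> 1"
      using fcl unfolding n_def by (metis One_nat_def Suc_leI card_gt_0_iff empty_iff)
    then show ?thesis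
      using out_bound[OF False greedy_subset that(2)] n_le[of ?X y, OF greedy_subset]
        n_split[of y] n_diff[OF \<open>?X \<subseteq> U\<close>, of y]
      unfolding K_def by (auto simp: of_bool_def min_def split: if_splits)
  qed
  have free: "K x y g = ?s + ?un" if "n M x = 0" "n M y = 0" for x y
    unfolding K_def using that n0 \<open>c v = g\<close> \<open>v \<in> M\<close>
    by (intro in_X) (fastforce simp: greedy_def greedy_first_def nbrs_def)
  \<comment> \<open>Three orders color \<open>v\<close>: the two that start with \<open>g\<close>,
    and \<open>y\<close>, \<open>g\<close>, \<open>x\<close>. With one marked and no unmarked
    neighbour of color \<open>x\<close>, the other three may cost 1 each, which the three gains of
    at least 1 just balance.\<close>
  have one: "0 \<le> 3 * (?s + ?un) + (K x g y + K x y g) + K y x g"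
    if "n M x > 0" "n M y = 0" "{x, y} = {a, b}" for x y
  proof -
    have xy: "x \<in> {a, b}" "y \<in> {a, b}" "y \<noteq> x" using that(3) dist(3) by (auto simp: doubleton_eq_iff)
    have s: "?s \<ge> 1" "?un \<ge> int (n (U - M) x)"
      using that(1) xy(1) n_split[of x] by auto
    then show ?thesis
      using hit[OF xy(1) that(1), of g y] hit[OF xy(1) that(1), of y g] third[OF that(2) xy(1,2,3)] that(1)
      by (cases "n M x = 1"; cases "n (U - M) x = 0") (auto simp: min_def split: if_splits)
  qed
  consider "n M a = 0" "n M b = 0" | "n M a > 0" "n M b = 0" | "n M a = 0" "n M b > 0"
    | "n M a > 0" "n M b > 0" by auto
  then show ?thesis
  proof cases
    case 1
    then show ?thesis
      using first second[of a b] second[of b a] free[of a b] free[of b a] dist by simp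
  next
    case 2
    then show ?thesis using one[of a b] first[of a b] first[of b a] second[of b a] dist by simp
  next
    case 3
    then show ?thesis
      using one[of b a] first[of a b] first[of b a] second[of a b] dist by (simp add: insert_commute)
  next
    case 4
    \<comment> \<open>For each of \<open>a\<close> and \<open>b\<close>, the two orders starting
      with it lose 4 at worst. The orders starting with \<open>g\<close> give back 2 since
      \<open>v\<close> sees the color; another 2 come from an unmarked neighbour of that color, or
      else from the color going out of sight.\<close>
    have "?s = 2" using 4 n_split[of a] n_split[of b] by simp
    moreover have "int (n (U - M) x) + of_bool (n (U - M) x = 0) \<ge> (1 :: int)" for x by simp
    note this[of a] this[of b]
    ultimately show ?thesis
      using first[of a b] first[of b a] 4
        hit[of a g b] hit[of b g a] hit[of a b g] hit[of b a g] by simp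
  qed
qed

lemma ex_nonneg_if_sum_nonneg:
  fixes t :: "'b \<Rightarrow> int"
  assumes "0 \<le> sum t P" "finite P" "P \<noteq> {}"
  shows "\<exists>x\<in>P. 0 \<le> t x"
  using sum_strict_mono[of P t "\<lambda>_. 0"] assms by fastforce

theorem sum_color_cost_three_colorable:
  assumes G: "simple_graph V E" and "colorable 3 V E"
  shows "3 * sum_color_cost V E \<le> 5 * card V + card E"
proof -
  obtain c where c: "\<And>v. v \<in> V \<Longrightarrow> c v < 3" and proper: "\<And>u v. {u, v} \<in> E \<Longrightarrow> c u \<noteq> (c v :: nat)"
    using assms(2) by (auto simp: colorable_def)
  have cV: "c v \<in> {0, 1, 2}" if "v \<in> V" for v using c[OF that] by auto
  have fV: "finite V" using G by (simp add: simple_graph_def)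
  define \<Phi> where "\<Phi> S = 3 * card S + card (edges_in E S) + (\<Sum>v\<in>S. seen E c S v)" for S
  have "3 * sum_color_cost V E \<le> \<Phi> V"
  proof (rule sum_color_cost_le_potential[OF G])
    fix U M assume UM: "U \<subseteq> V" "M \<subseteq> U"
    have fU: "finite U" using UM(1) fV finite_subset by blast
    let ?X = "\<lambda>(p, q, r). greedy E c M p q r"
    let ?T = "\<lambda>X. int (\<Phi> U) - int (\<Phi> (U - X)) - 3 * int (card M)"
    let ?P = "{(0, 1, 2), (0, 2, 1), (1, 0, 2), (2, 0, 1), (1, 2, 0), (2, 1, 0)} :: (nat \<times> nat \<times> nat) set"
    have cU: "\<And>w. w \<in> U \<Longrightarrow> c w \<in> {0, 1, 2}" using cV UM(1) by blast
    have nonneg: "0 \<le> (\<Sum>\<pi>\<in>?P. share E c U M (?X \<pi>) v)" if "v \<in> M" for v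
    proof -
      have "v \<in> V" using that UM by blast
      from cV[OF this] consider "c v = 0" | "c v = 1" | "c v = 2" by auto
      then show ?thesis
      proof cases
        case 1
        then show ?thesis
          using sum_orders_share_nonneg[OF G fU UM(2) that, where c = c and g = 0 and a = 1 and b = 2] proper cU
          by (simp add: insert_commute)
      next
        case 2
        then show ?thesis
          using sum_orders_share_nonneg[OF G fU UM(2) that, where c = c and g = 1 and a = 0 and b = 2] proper cU
          by (simp add: insert_commute)
      next
        case 3
        then show ?thesis
          using sum_orders_share_nonneg[OF G fU UM(2) that, where c = c and g = 2 and a = 0 and b = 1] proper cU
          by (simp add: insert_commute)
      qed
    qed
    have "0 \<le> (\<Sum>v\<in>M. \<Sum>\<pi>\<in>?P. share E c U M (?X \<pi>) v)" using nonneg by (rule sum_nonneg)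
    also have "\<dots> = (\<Sum>\<pi>\<in>?P. \<Sum>v\<in>M. share E c U M (?X \<pi>) v)" by (rule sum.swap)
    also have "\<dots> \<le> (\<Sum>\<pi>\<in>?P. ?T (?X \<pi>))"
    proof (rule sum_mono)
      fix \<pi> :: "nat \<times> nat \<times> nat"
      have "?X \<pi> \<subseteq> M" by (cases \<pi>) (simp add: greedy_subset)
      from sum_share_le[OF G fU UM(2) this, of c]
      show "(\<Sum>v\<in>M. share E c U M (?X \<pi>) v) \<le> ?T (?X \<pi>)" by (simp only: \<Phi>_def)
    qed
    finally have sum: "0 \<le> (\<Sum>\<pi>\<in>?P. ?T (?X \<pi>))" .
    have "\<exists>\<pi>\<in>?P. 0 \<le> ?T (?X \<pi>)"
      by (rule ex_nonneg_if_sum_nonneg[OF sum]) auto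
    then obtain p q r where "0 \<le> ?T (greedy E c M p q r)" by (elim bexE) (auto split: prod.splits)
    then show "\<exists>X\<subseteq>M. independent_in E X \<and> 3 * card M + \<Phi> (U - X) \<le> \<Phi> U"
      using greedy_subset[of E c M p q r] independent_greedy[OF G, of c M p q r] proper
      by (intro exI[of _ "greedy E c M p q r"]) auto
  qed simp
  also have "\<Phi> V \<le> 5 * card V + card E"
  proof -
    \<comment> \<open>No vertex sees its own color; the 5 in the bound is 3 + 2.\<close>
    have "seen E c V v \<le> 2" if "v \<in> V" for v
    proof -
      have "c ` nbrs E V v \<subseteq> {0, 1, 2} - {c v}" using cV proper by (fastforce simp: nbrs_def)
      then have "card (c ` nbrs E V v) \<le> card ({0, 1, 2} - {c v})" by (intro card_mono) auto
      then show ?thesis using cV[OF that] by (auto simp: seen_def)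
    qed
    then have "(\<Sum>v\<in>V. seen E c V v) \<le> (\<Sum>v\<in>V. 2)" by (rule sum_mono)
    then show ?thesis by (simp add: \<Phi>_def edges_in_V[OF G])
  qed
  finally show ?thesis .
qed

subsection \<open>Minor-closed classes\<close>

text \<open>The new vertex keeps the name \<open>x\<close>.\<close>

definition contract :: "'a set set \<Rightarrow> 'a \<Rightarrow> 'a \<Rightarrow> 'a set set" where
  "contract F x y = {e\<in>F. y \<notin> e} \<union> {{x, v} |v. {y, v} \<in> F \<and> v \<noteq> x}"

definition clique :: "'a set set \<Rightarrow> 'a set \<Rightarrow> bool" where
  "clique F Q \<longleftrightarrow> (\<forall>u\<in>Q. \<forall>v\<in>Q. u \<noteq> v \<longrightarrow> {u, v} \<in> F)"

text \<open>An abstract class keeps the edge bounds and colorings free of branch sets; it is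
  instantiated with the minors of one fixed graph.\<close>

definition minor_closed :: "('a set \<Rightarrow> 'a set set \<Rightarrow> bool) \<Rightarrow> bool" where
  "minor_closed P \<longleftrightarrow>
     (\<forall>W F. P W F \<longrightarrow> simple_graph W F) \<and>
     (\<forall>W F F'. P W F \<longrightarrow> F' \<subseteq> F \<longrightarrow> P W F') \<and>
     (\<forall>W F w. P W F \<longrightarrow> P (W - {w}) (edges_in F (W - {w}))) \<and>
     (\<forall>W F x y. P W F \<longrightarrow> {x, y} \<in> F \<longrightarrow> P (W - {y}) (contract F x y))"

lemma minor_closedD:
  assumes "minor_closed P" "P W F"
  shows "simple_graph W F" "\<And>F'. F' \<subseteq> F \<Longrightarrow> P W F'"
    "\<And>w. P (W - {w}) (edges_in F (W - {w}))"
    "\<And>x y. {x, y} \<in> F \<Longrightarrow> P (W - {y}) (contract F x y)"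
  using assms unfolding minor_closed_def by blast+

lemma nbrs_iff [simp]: "w \<in> nbrs E S v \<longleftrightarrow> w \<in> S \<and> {v, w} \<in> E"
  by (auto simp: nbrs_def)

lemma nbrs_subset [simp]: "nbrs E S v \<subseteq> S"
  by auto

lemma edges_at:
  assumes G: "simple_graph W F"
  shows "{e\<in>F. v \<in> e} = (\<lambda>w. {v, w}) ` nbrs F W v"
proof
  show "{e\<in>F. v \<in> e} \<subseteq> (\<lambda>w. {v, w}) ` nbrs F W v"
  proof
    fix e assume e: "e \<in> {e\<in>F. v \<in> e}"
    then have "card e = 2" "e \<subseteq> W" using G by (auto simp: simple_graph_def)
    then obtain a b where "e = {a, b}" by (auto simp: card_2_iff)
    then obtain w where "e = {v, w}" using e by auto
    then show "e \<in> (\<lambda>w. {v, w}) ` nbrs F W v" using e \<open>e \<subseteq> W\<close> by auto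
  qed
qed auto

lemma card_edges_at:
  assumes "simple_graph W F"
  shows "card {e\<in>F. v \<in> e} = card (nbrs F W v)"
  unfolding edges_at[OF assms] by (rule card_image) (auto simp: inj_on_def doubleton_eq_iff)

lemma sum_degrees:
  assumes G: "simple_graph W F"
  shows "(\<Sum>v\<in>W. card (nbrs F W v)) = 2 * card F"
proof -
  have fin: "finite W" "finite F" using G simple_graph_finite_E by (auto simp: simple_graph_def)
  have "(\<Sum>v\<in>W. card (nbrs F W v)) = (\<Sum>v\<in>W. card {e\<in>F. v \<in> e})"
    by (simp add: card_edges_at[OF G])
  also have "\<dots> = (\<Sum>e\<in>F. card {v\<in>W. v \<in> e})"
    using sum.swap_restrict[OF fin, of "\<lambda>_ _. 1" "\<lambda>v e. v \<in> e"] by (simp only: card_eq_sum)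
  also have "\<dots> = (\<Sum>e\<in>F. 2)"
  proof (rule sum.cong)
    fix e assume "e \<in> F"
    then have "card e = 2" "{v\<in>W. v \<in> e} = e" using G by (auto simp: simple_graph_def)
    then show "card {v\<in>W. v \<in> e} = 2" by simp
  qed simp
  finally show ?thesis by simp
qed

lemma obtain_low_degree:
  assumes G: "simple_graph W F" and "W \<noteq> {}" "2 * card F < Suc d * card W"
  obtains v where "v \<in> W" "card (nbrs F W v) \<le> d"
proof (rule ccontr)
  assume "\<not> thesis"
  then have "\<forall>v\<in>W. Suc d \<le> card (nbrs F W v)" using that by (metis not_less_eq_eq)
  then have "Suc d \<le> card (nbrs F W v)" if "v \<in> W" for v using that by blast
  then have "(\<Sum>v\<in>W. Suc d) \<le> (\<Sum>v\<in>W. card (nbrs F W v))" by (rule sum_mono)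
  then show False using sum_degrees[OF G] assms(3) by (simp add: mult.commute)
qed

lemma card_nbrs_less:
  assumes G: "simple_graph W F" "v \<in> W"
  shows "card (nbrs F W v) \<le> card W - 1"
proof -
  have "nbrs F W v \<subseteq> W - {v}" using no_loop[OF G(1)] by auto
  then have "card (nbrs F W v) \<le> card (W - {v})"
    using G by (intro card_mono) (auto simp: simple_graph_def)
  then show ?thesis using G by (simp add: simple_graph_def)
qed

text \<open>Apart from \<open>{x, y}\<close> itself, edges are lost only at common neighbours, where
  two edges become one.\<close>

lemma card_contract:
  assumes G: "simple_graph W F" and xy: "{x, y} \<in> F"
  shows "card F \<le> card (contract F x y) + 1 + card (nbrs F W x \<inter> nbrs F W y)"
proof -
  have fin: "finite W" "finite F" using G simple_graph_finite_E by (auto simp: simple_graph_def)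
  have fc: "finite (contract F x y)"
  proof (rule finite_subset)
    show "contract F x y \<subseteq> F \<union> (\<lambda>v. {x, v}) ` W"
      using edge_in[OF G] by (auto simp: contract_def)
  qed (use fin in auto)
  let ?Y = "nbrs F W y - nbrs F W x - {x}"
  have "x \<noteq> y" "x \<in> W" "y \<in> W" using edge_neq[OF G xy] edge_in[OF G xy] by auto
  have "card {e\<in>F. y \<notin> e} + card ?Y = card {e\<in>F. y \<notin> e} + card ((\<lambda>v. {x, v}) ` ?Y)"
    by (subst card_image) (auto simp: inj_on_def doubleton_eq_iff)
  also have "\<dots> = card ({e\<in>F. y \<notin> e} \<union> (\<lambda>v. {x, v}) ` ?Y)"
    using fin by (intro card_Un_disjoint[symmetric]) auto
  also have "\<dots> \<le> card (contract F x y)"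
    using fc by (intro card_mono) (auto simp: contract_def)
  finally have 1: "card {e\<in>F. y \<notin> e} + card ?Y \<le> card (contract F x y)" .
  have "F = {e\<in>F. y \<notin> e} \<union> {e\<in>F. y \<in> e}" by blast
  then have "card F = card ({e\<in>F. y \<notin> e} \<union> {e\<in>F. y \<in> e})" by simp
  also have "\<dots> = card {e\<in>F. y \<notin> e} + card (nbrs F W y)"
    using fin by (subst card_Un_disjoint) (auto simp: card_edges_at[OF G])
  finally have 2: "card F = card {e\<in>F. y \<notin> e} + card (nbrs F W y)" .
  have "nbrs F W y \<subseteq> insert x (?Y \<union> (nbrs F W x \<inter> nbrs F W y))" by auto
  then have "card (nbrs F W y) \<le> card (insert x (?Y \<union> (nbrs F W x \<inter> nbrs F W y)))"
    using fin by (intro card_mono) auto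
  also have "\<dots> \<le> Suc (card (?Y \<union> (nbrs F W x \<inter> nbrs F W y)))" by (rule card_insert_le_m1) auto
  also have "\<dots> \<le> Suc (card ?Y + card (nbrs F W x \<inter> nbrs F W y))" using card_Un_le by simp
  finally show ?thesis using 1 2 by simp
qed

lemma obtain_subset_card:
  assumes "n \<le> card (F :: 'b set)"
  obtains F' where "F' \<subseteq> F" "card F' = n"
  using assms obtain_subset_with_card_n by metis

lemma card_edges_le:
  assumes G: "simple_graph W F"
  shows "2 * card F \<le> card W * (card W - 1)"
proof -
  have "2 * card F = (\<Sum>v\<in>W. card (nbrs F W v))" using sum_degrees[OF G] by simp
  also have "\<dots> \<le> (\<Sum>v\<in>W. card W - 1)" using card_nbrs_less[OF G] by (rule sum_mono)
  finally show ?thesis by simp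
qed

text \<open>Thin out a minimal counterexample until it has just one edge too many. A contraction must then
  lose more than \<open>a\<close> edges, so every edge lies in at least \<open>a\<close> triangles.\<close>

lemma obtain_dense_neighbourhood:
  assumes P: "minor_closed P" "P W F"
    and IH: "\<forall>W' F'. P W' F' \<longrightarrow> card W' < card W \<longrightarrow> a \<le> card W' \<longrightarrow> card F' + b < a * card W'"
    and n: "a < card W" "a * card W \<le> card F + b" "a \<ge> 1" "b \<ge> 1" "b \<le> a * a"
  obtains F' v where "F' \<subseteq> F" "v \<in> W" "card (nbrs F' W v) < 2 * a" "a < card (nbrs F' W v)"
    "\<And>x. x \<in> nbrs F' W v \<Longrightarrow> a \<le> card (nbrs F' W x \<inter> nbrs F' W v)"
proof -
  note small = IH[rule_format]
  \<comment> \<open>Ensures that the subtraction in \<open>a * card W - b\<close> is not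
    truncated.\<close>
  have ab: "b \<le> a * card W" using le_trans[OF n(5), of "a * card W"] n(1) by simp
  have "a * card W - b \<le> card F" using n by simp
  then obtain F' where F': "F' \<subseteq> F" "card F' = a * card W - b" by (rule obtain_subset_card)
  note P' = minor_closedD(2)[OF P F'(1)]
  note G = minor_closedD(1)[OF P(1) P']
  have fW: "finite W" using G by (simp add: simple_graph_def)
  have triangles: "a \<le> card (nbrs F' W x \<inter> nbrs F' W y)" if "{x, y} \<in> F'" for x y
  proof (rule ccontr)
    assume "\<not> a \<le> card (nbrs F' W x \<inter> nbrs F' W y)"
    then have "card F' \<le> card (contract F' x y) + a" using card_contract[OF G that] by simp
    moreover have "card (W - {y}) = card W - 1" using edge_in[OF G that] fW by simp
    then have "card (contract F' x y) + b < a * (card W - 1)"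
      using small[OF minor_closedD(4)[OF P(1) P' that]] n(1) by simp
    moreover have "a * (card W - 1) + a = a * card W" using n(1) by (metis Suc_pred' add.commute bot_nat_0.not_eq_extremum mult_Suc_right not_less_zero)
    ultimately show False using F'(2) ab by simp
  qed
  have "W \<noteq> {}" using n(1) by auto
  \<comment> \<open>The average degree is below \<open>2 * a\<close> because
    \<open>b \<ge> 1\<close>.\<close>
  have "2 * card F' < 2 * a * card W" using F'(2) n ab by (simp add: algebra_simps)
  then have "2 * card F' < Suc (2 * a - 1) * card W" using n(3) by simp
  then obtain v where v: "v \<in> W" "card (nbrs F' W v) \<le> 2 * a - 1"
    using obtain_low_degree[OF G \<open>W \<noteq> {}\<close>] by blast
  have cW: "card (W - {v}) = card W - 1" using v(1) fW by simp
  \<comment> \<open>An isolated \<open>v\<close> could be deleted without losing an edge, against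
    the bound for smaller graphs.\<close>
  have "nbrs F' W v \<noteq> {}"
  proof
    assume no: "nbrs F' W v = {}"
    have "edges_in F' (W - {v}) = F'"
    proof -
      have "{e\<in>F'. v \<in> e} = {}" using no edges_at[OF G, of v] by simp
      then show ?thesis using G by (auto simp: edges_in_def simple_graph_def)
    qed
    then have "P (W - {v}) F'" using minor_closedD(3)[OF P(1) P', of v] by simp
    then have "card F' + b < a * (card W - 1)" using small[of "W - {v}" F'] cW n(1) by simp
    moreover have "a * (card W - 1) \<le> a * card W" by simp
    ultimately show False using F'(2) ab by linarith
  qed
  then obtain x where x: "x \<in> nbrs F' W v" by blast
  have nb: "a \<le> card (nbrs F' W x \<inter> nbrs F' W v)" if "x \<in> nbrs F' W v" for x
    using triangles[of x v] that by (simp add: insert_commute)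
  \<comment> \<open>A neighbour \<open>x\<close> and the common neighbours of \<open>x\<close> and
    \<open>v\<close>, at least \<open>a\<close> in number, all count towards the degree of
    \<open>v\<close>.\<close>
  have "insert x (nbrs F' W x \<inter> nbrs F' W v) \<subseteq> nbrs F' W v" using x by auto
  then have "card (insert x (nbrs F' W x \<inter> nbrs F' W v)) \<le> card (nbrs F' W v)"
    using fW by (intro card_mono) auto
  moreover have "x \<notin> nbrs F' W x" using no_loop[OF G] by simp
  ultimately have "a < card (nbrs F' W v)" using nb[OF x] fW by simp
  then show ?thesis using that[OF F'(1) v(1) _ _ nb] v(2) n(3) by simp
qed

subsection \<open>Classes without small complete graphs\<close>

definition excludes_clique :: "nat \<Rightarrow> ('a set \<Rightarrow> 'a set set \<Rightarrow> bool) \<Rightarrow> bool" where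
  "excludes_clique t P \<longleftrightarrow> (\<forall>W F Q. P W F \<longrightarrow> Q \<subseteq> W \<longrightarrow> clique F Q \<longrightarrow> card Q \<noteq> t)"

lemma excludes_cliqueD:
  "excludes_clique t P \<Longrightarrow> P W F \<Longrightarrow> Q \<subseteq> W \<Longrightarrow> clique F Q \<Longrightarrow> card Q \<noteq> t"
  by (simp add: excludes_clique_def)

lemma cliqueI_insert:
  assumes "clique F Q" "\<And>u. u \<in> Q \<Longrightarrow> u \<noteq> v \<Longrightarrow> {v, u} \<in> F"
  shows "clique F (insert v Q)"
  using assms by (auto simp: clique_def insert_commute)

text \<open>With \<open>a = b = 2\<close>, too many edges yield a vertex of degree exactly 3 whose
  neighbours are pairwise adjacent, hence a K4. The strict inequality is the bound 2 n - 3.\<close>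

lemma K4_free_sparse:
  assumes P: "minor_closed P"
    and K4: "excludes_clique 4 P"
    and "P W F" "2 \<le> card W"
  shows "card F + 2 < 2 * card W"
  using \<open>P W F\<close> \<open>2 \<le> card W\<close>
proof (induction "card W" arbitrary: W F rule: less_induct)
  case less
  note G = minor_closedD(1)[OF P less.prems(1)]
  show ?case
  proof (rule ccontr)
    assume dense: "\<not> card F + 2 < 2 * card W"
    have "2 < card W"
    proof (rule ccontr)
      assume "\<not> 2 < card W"
      then have "card W = 2" using less.prems(2) by simp
      then show False using card_edges_le[OF G] dense by simp
    qed
    have small: "\<forall>W' F'. P W' F' \<longrightarrow> card W' < card W \<longrightarrow> 2 \<le> card W' \<longrightarrow> card F' + 2 < 2 * card W'"
      using less.hyps by blast
    have "2 * card W \<le> card F + 2" "1 \<le> (2 :: nat)" "1 \<le> (2 :: nat)" "2 \<le> 2 * (2 :: nat)"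
      using dense by simp_all
    from obtain_dense_neighbourhood[OF P less.prems(1) small \<open>2 < card W\<close> this]
    obtain F' v where F': "F' \<subseteq> F" and v: "v \<in> W" "card (nbrs F' W v) < 2 * 2" "2 < card (nbrs F' W v)"
      and nb: "\<And>x. x \<in> nbrs F' W v \<Longrightarrow> 2 \<le> card (nbrs F' W x \<inter> nbrs F' W v)"
      by blast
    note P' = minor_closedD(2)[OF P less.prems(1) F']
    note G' = minor_closedD(1)[OF P P']
    let ?N = "nbrs F' W v"
    have fN: "finite ?N" using G' by (simp add: simple_graph_def)
    have c3: "card ?N = 3" using v by simp
    have "{x, y} \<in> F'" if "x \<in> ?N" "y \<in> ?N" "x \<noteq> y" for x y
    proof -
      have sub: "nbrs F' W x \<inter> ?N \<subseteq> ?N - {x}" using no_loop[OF G'] by auto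
      have "card (?N - {x}) \<le> card (nbrs F' W x \<inter> ?N)" using nb[OF that(1)] c3 that(1) fN by simp
      then have eq: "nbrs F' W x \<inter> ?N = ?N - {x}" by (rule card_seteq[OF finite_Diff[OF fN] sub])
      have "y \<in> ?N - {x}" using that by blast
      then have "y \<in> nbrs F' W x" unfolding eq[symmetric] by blast
      then show ?thesis by simp
    qed
    then have "clique F' (insert v ?N)" by (intro cliqueI_insert) (auto simp: clique_def)
    moreover have "card (insert v ?N) = 4" using c3 fN no_loop[OF G'] by simp
    ultimately show False using excludes_cliqueD[OF K4 P', of "insert v ?N"] v(1) by auto
  qed
qed

text \<open>The neighbourhood found above is a complete graph on four vertices, or it has five vertices
  and its non-edges form a matching. In the second case, contracting one of its edges completes a
  clique.\<close>

lemma K5_free_sparse: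
  assumes P: "minor_closed P"
    and K5: "excludes_clique 5 P"
    and "P W F" "3 \<le> card W"
  shows "card F + 5 < 3 * card W"
  using \<open>P W F\<close> \<open>3 \<le> card W\<close>
proof (induction "card W" arbitrary: W F rule: less_induct)
  case less
  note G = minor_closedD(1)[OF P less.prems(1)]
  show ?case
  proof (rule ccontr)
    assume dense: "\<not> card F + 5 < 3 * card W"
    have "3 < card W"
    proof (rule ccontr)
      assume "\<not> 3 < card W"
      then have "card W = 3" using less.prems(2) by simp
      then show False using card_edges_le[OF G] dense by simp
    qed
    have small: "\<forall>W' F'. P W' F' \<longrightarrow> card W' < card W \<longrightarrow> 3 \<le> card W' \<longrightarrow> card F' + 5 < 3 * card W'"
      using less.hyps by blast
    have "3 * card W \<le> card F + 5" "1 \<le> (3 :: nat)" "1 \<le> (5 :: nat)" "5 \<le> 3 * (3 :: nat)"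
      using dense by simp_all
    from obtain_dense_neighbourhood[OF P less.prems(1) small \<open>3 < card W\<close> this]
    obtain F' v where F': "F' \<subseteq> F" and v: "v \<in> W" "card (nbrs F' W v) < 2 * 3" "3 < card (nbrs F' W v)"
      and nb: "\<And>x. x \<in> nbrs F' W v \<Longrightarrow> 3 \<le> card (nbrs F' W x \<inter> nbrs F' W v)"
      by blast
    note P' = minor_closedD(2)[OF P less.prems(1) F']
    note G' = minor_closedD(1)[OF P P']
    let ?N = "nbrs F' W v"
    have fN: "finite ?N" using G' by (simp add: simple_graph_def)
    have loop: "{u} \<notin> F'" for u using no_loop[OF G'] .
    have full: "\<not> clique F' Q" if "Q \<subseteq> ?N" "card Q = 4" for Q
    proof
      assume "clique F' Q"
      then have "clique F' (insert v Q)" using that(1) by (intro cliqueI_insert) auto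
      moreover have "v \<notin> Q" using that(1) loop by auto
      then have "card (insert v Q) = 5" using that fN finite_subset[OF that(1)] by simp
      moreover have "insert v Q \<subseteq> W" using that(1) nbrs_subset[of F' W v] v(1) by blast
      ultimately show False using excludes_cliqueD[OF K5 P'] by blast
    qed
    consider "card ?N = 4" | "card ?N = 5" using v by linarith
    then show False
    proof cases
      case 1
      have "clique F' ?N" unfolding clique_def
      proof (intro ballI impI)
        fix x y assume xy: "x \<in> ?N" "y \<in> ?N" "x \<noteq> y"
        have sub: "nbrs F' W x \<inter> ?N \<subseteq> ?N - {x}" using loop by auto
        have "card (?N - {x}) \<le> card (nbrs F' W x \<inter> ?N)" using nb[OF xy(1)] 1 xy(1) fN by simp
        then have eq: "nbrs F' W x \<inter> ?N = ?N - {x}" by (rule card_seteq[OF finite_Diff[OF fN] sub])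
        have "y \<in> ?N - {x}" using xy by blast
        then have "y \<in> nbrs F' W x" unfolding eq[symmetric] by blast
        then show "{x, y} \<in> F'" by simp
      qed
      then show False using full[of ?N] 1 by simp
    next
      case 2
      have one_non: "y = z" if "x \<in> ?N" "y \<in> ?N" "z \<in> ?N" "y \<noteq> x" "z \<noteq> x" "{x, y} \<notin> F'" "{x, z} \<notin> F'" for x y z
      proof (rule ccontr)
        assume "y \<noteq> z"
        have "nbrs F' W x \<inter> ?N \<subseteq> ?N - {x, y, z}" using that loop by auto
        then have "card (nbrs F' W x \<inter> ?N) \<le> card (?N - {x, y, z})" using fN by (intro card_mono) auto
        also have "\<dots> = 2" using 2 that \<open>y \<noteq> z\<close> fN by (subst card_Diff_subset) auto
        finally show False using nb[OF that(1)] by simp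
      qed
      obtain Q where Q: "Q \<subseteq> ?N" "card Q = 4" using obtain_subset_card[of 4 ?N] 2 by auto
      then obtain a a' where a: "a \<in> ?N" "a' \<in> ?N" "a \<noteq> a'" "{a, a'} \<notin> F'"
        using full[OF Q] unfolding clique_def by blast
      have "card (?N - {a, a'}) = 3" using 2 a fN by (subst card_Diff_subset) auto
      then obtain p q r where set: "?N - {a, a'} = {p, q, r}" and ne: "p \<noteq> q" "q \<noteq> r" "p \<noteq> r"
        unfolding card_3_iff by blast
      have pqr: "{p, q, r} \<subseteq> ?N - {a, a'}" unfolding set by blast
      then have N: "p \<in> ?N" "q \<in> ?N" "r \<in> ?N" by simp_all
      \<comment> \<open>By \<open>one_non\<close>, at most one of the three pairs is a non-edge; the
        renaming makes \<open>{p, q}\<close> the only candidate.\<close>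
      have "\<exists>p q r. {p, q, r} \<subseteq> ?N - {a, a'} \<and> p \<noteq> q \<and> q \<noteq> r \<and> p \<noteq> r \<and> {q, r} \<in> F' \<and> {p, r} \<in> F'"
      proof (cases "{p, r} \<in> F' \<and> {q, r} \<in> F'")
        case True
        then show ?thesis using pqr ne by (intro exI[of _ p] exI[of _ q] exI[of _ r]) simp
      next
        case False
        show ?thesis
        proof (cases "{p, r} \<in> F'")
          case True
          then have "{q, r} \<notin> F'" using False by blast
          then have "{p, q} \<in> F'" using one_non[of q r p] N ne by (metis insert_commute)
          then show ?thesis using True pqr ne
            by (intro exI[of _ r] exI[of _ q] exI[of _ p]) (simp add: insert_commute)
        next
          case no: False
          then have "{p, q} \<in> F'" "{q, r} \<in> F'"
            using one_non[of p r q] one_non[of r p q] N ne by (metis insert_commute)+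
          then show ?thesis using pqr ne
            by (intro exI[of _ r] exI[of _ p] exI[of _ q]) (simp add: insert_commute)
        qed
      qed
      then obtain p q r where pqr: "{p, q, r} \<subseteq> ?N - {a, a'}" "p \<noteq> q" "q \<noteq> r" "p \<noteq> r" "{q, r} \<in> F'" "{p, r} \<in> F'"
        by blast
      have N: "p \<in> ?N" "q \<in> ?N" "r \<in> ?N" "p \<notin> {a, a'}" "q \<notin> {a, a'}" "r \<notin> {a, a'}" using pqr(1) by auto
      have aa: "{x, y} \<in> F'" if "x \<in> {a, a'}" "y \<in> ?N - {a, a'}" for x y
      proof (rule ccontr)
        assume no: "{x, y} \<notin> F'"
        have "{a', a} \<notin> F'" using a(4) by (simp add: insert_commute)
        then show False using one_non[of a y a'] one_non[of a' y a] no that a by auto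
      qed
      have E: "{a, p} \<in> F'" "{a, q} \<in> F'" "{a, r} \<in> F'" "{a', p} \<in> F'" "{a', q} \<in> F'" "{a', r} \<in> F'"
        using aa N by simp_all
      have Ev: "{v, x} \<in> F'" if "x \<in> ?N" for x using that by simp
      \<comment> \<open>The edge \<open>{a', p}\<close> becomes the missing \<open>{a, a'}\<close>.
        All other pairs among \<open>v\<close>, \<open>a\<close>, \<open>a'\<close>,
        \<open>q\<close>, \<open>r\<close> are already edges, and they avoid
        \<open>p\<close>.\<close>
      let ?C = "contract F' a p"
      have "{a, a'} \<in> ?C" using E(4) a(3) by (auto simp: contract_def insert_commute)
      moreover have "{a, q} \<in> ?C" "{a, r} \<in> ?C" "{a', q} \<in> ?C" "{a', r} \<in> ?C" "{q, r} \<in> ?C"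
        using E pqr N by (auto simp: contract_def)
      moreover have "{v, x} \<in> ?C" if "x \<in> {a, a', q, r}" for x
        using that Ev a N(1,2,3,4) pqr loop by (auto simp: contract_def)
      ultimately have "clique ?C {v, a, a', q, r}" by (auto simp: clique_def insert_commute)
      moreover have "v \<notin> {a, a', q, r}" using a(1,2) N(2,3) loop by auto
      then have "card {v, a, a', q, r} = 5" using a(3) N(5,6) pqr by (auto simp: card_insert_if)
      moreover have "v \<noteq> p" using N(1) loop by auto
      then have "{v, a, a', q, r} \<subseteq> W - {p}" using a(1,2) N pqr v(1) by auto
      ultimately show False using excludes_cliqueD[OF K5 minor_closedD(4)[OF P P' E(1)]] by blast
    qed
  qed
qed

text \<open>If the chosen vertex \<open>v\<close> has degree \<open>k\<close>, two of its neighbours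
  are nonadjacent, as otherwise they would form a clique of size \<open>Suc k\<close> with
  \<open>v\<close>. Merging these two with \<open>v\<close> and coloring the resulting minor gives
  them a common color, which leaves one free for \<open>v\<close>. Below degree \<open>k\<close>,
  deleting \<open>v\<close> is enough.\<close>

lemma colorable_if_low_degree:
  assumes P: "minor_closed P"
    and low: "\<And>W F. P W F \<Longrightarrow> W \<noteq> {} \<Longrightarrow> \<exists>v\<in>W. card (nbrs F W v) \<le> k"
    and K: "excludes_clique (Suc k) P"
    and "P W F"
  shows "colorable k W F"
  using \<open>P W F\<close>
proof (induction "card W" arbitrary: W F rule: less_induct)
  case less
  note G = minor_closedD(1)[OF P less.prems]
  have fW: "finite W" using G by (simp add: simple_graph_def)
  have edge: "u \<in> W" "w \<in> W" "u \<noteq> w" if "{u, w} \<in> F" for u w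
    using edge_in[OF G that] edge_neq[OF G that] by auto
  show ?case
  proof (cases "W = {}")
    case True
    then show ?thesis using edge by (auto simp: colorable_def)
  next
    case False
    then obtain v where v: "v \<in> W" "card (nbrs F W v) \<le> k" using low[OF less.prems] by blast
    let ?N = "nbrs F W v"
    have fN: "finite ?N" using fW by simp
    have "\<exists>c. (\<forall>u\<in>W - {v}. c u < k) \<and> (\<forall>u w. {u, w} \<in> F \<longrightarrow> u \<noteq> v \<longrightarrow> w \<noteq> v \<longrightarrow> c u \<noteq> c w) \<and>
        card (c ` ?N) < k"
    proof (cases "card ?N < k")
      case True
      have "card (W - {v}) < card W" using v(1) fW by (meson card_Diff1_less)
      then have "colorable k (W - {v}) (edges_in F (W - {v}))"
        using less.hyps minor_closedD(3)[OF P less.prems] by blast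
      then obtain c where c: "\<forall>u\<in>W - {v}. c u < k" "\<forall>u w. {u, w} \<in> edges_in F (W - {v}) \<longrightarrow> c u \<noteq> (c w :: nat)"
        by (auto simp: colorable_def)
      have "card (c ` ?N) < k" using True card_image_le[OF fN, of c] by simp
      moreover have "c u \<noteq> c w" if "{u, w} \<in> F" "u \<noteq> v" "w \<noteq> v" for u w
        using c(2) that edge[OF that(1)] by (auto simp: edges_in_def)
      ultimately show ?thesis using c(1) by blast
    next
      case False
      have "\<not> clique F ?N"
      proof
        assume "clique F ?N"
        then have "clique F (insert v ?N)" by (intro cliqueI_insert) auto
        moreover have "v \<notin> ?N" using no_loop[OF G] by simp
        then have "card (insert v ?N) = Suc k" using False v(2) fN by simp
        moreover have "insert v ?N \<subseteq> W" using v(1) nbrs_subset[of F W v] by blast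
        ultimately show False using excludes_cliqueD[OF K less.prems] by blast
      qed
      then obtain x y where xy: "x \<in> ?N" "y \<in> ?N" "x \<noteq> y" "{x, y} \<notin> F" unfolding clique_def by blast
      have ne: "v \<noteq> x" "v \<noteq> y" using xy edge(3)[of v] by auto
      \<comment> \<open>Contracting \<open>v\<close> into \<open>x\<close> makes
        \<open>{x, y}\<close> an edge, along which the second contraction takes place.\<close>
      let ?F1 = "contract F x v" and ?F2 = "contract (contract F x v) x y"
      have 1: "P (W - {v}) ?F1" using minor_closedD(4)[OF P less.prems, of x v] xy by (simp add: insert_commute)
      have "{x, y} \<in> ?F1" using xy by (auto simp: contract_def)
      then have 2: "P (W - {v} - {y}) ?F2" using minor_closedD(4)[OF P 1] by blast
      have "card (W - {v} - {y}) < card W"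
        using v(1) fW by (intro psubset_card_mono) auto
      then have "colorable k (W - {v} - {y}) ?F2" using less.hyps 2 by blast
      then obtain c where c: "\<forall>u\<in>W - {v} - {y}. c u < k" "\<And>u w. {u, w} \<in> ?F2 \<Longrightarrow> c u \<noteq> (c w :: nat)"
        by (auto simp: colorable_def)
      let ?c = "c(y := c x)"
      have y_nbr: "c x \<noteq> c w" if "{y, w} \<in> F" "w \<noteq> v" for w
      proof -
        have "w \<noteq> x" using that(1) xy(4) by (auto simp: insert_commute)
        then have "{x, w} \<in> ?F2" using that ne by (auto simp: contract_def)
        then show ?thesis using c(2) by blast
      qed
      have "?c u \<noteq> ?c w" if "{u, w} \<in> F" "u \<noteq> v" "w \<noteq> v" for u w
      proof -
        consider "u = y" | "w = y" | "u \<noteq> y" "w \<noteq> y" by blast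
        then show ?thesis
        proof cases
          case 1
          then show ?thesis using y_nbr[of w] that edge(3)[OF that(1)] by auto
        next
          case 2
          then show ?thesis using y_nbr[of u] that edge(3)[OF that(1)] by (auto simp: insert_commute)
        next
          case 3
          then have "{u, w} \<in> ?F2" using that by (auto simp: contract_def)
          then show ?thesis using c(2) 3 by auto
        qed
      qed
      moreover have "?c u < k" if "u \<in> W - {v}" for u
        using that c(1) xy ne by auto
      moreover have "card (?c ` ?N) < k"
      proof -
        have "?c ` ?N = ?c ` (?N - {y})" using xy by auto
        also have "card \<dots> \<le> card (?N - {y})" using fN by (intro card_image_le) auto
        also have "\<dots> < card ?N" using xy fN by (meson card_Diff1_less)
        finally show ?thesis using v(2) by simp
      qed
      ultimately show ?thesis by blast
    qed
    then obtain c where c: "\<And>u. u \<in> W - {v} \<Longrightarrow> c u < k"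
      "\<And>u w. {u, w} \<in> F \<Longrightarrow> u \<noteq> v \<Longrightarrow> w \<noteq> v \<Longrightarrow> c u \<noteq> c w" "card (c ` ?N) < k"
      by blast
    have "\<not> {..<k} \<subseteq> c ` ?N"
    proof
      assume "{..<k} \<subseteq> c ` ?N"
      then have "card {..<k} \<le> card (c ` ?N)" using fN by (intro card_mono) auto
      then show False using c(3) by simp
    qed
    then obtain i where i: "i < k" "i \<notin> c ` ?N" by auto
    have "(c(v := i)) u \<noteq> (c(v := i)) w" if "{u, w} \<in> F" for u w
    proof -
      have "{w, u} \<in> F" using that by (simp add: insert_commute)
      then show ?thesis using that c(2)[OF that] i(2) edge[OF that] by auto
    qed
    moreover have "(c(v := i)) u < k" if "u \<in> W" for u using c(1) i(1) that by auto
    ultimately show ?thesis unfolding colorable_def by blast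
  qed
qed

lemma K4_free_three_colorable:
  assumes P: "minor_closed P"
    and K4: "excludes_clique 4 P"
    and "P W F"
  shows "colorable 3 W F"
proof (rule colorable_if_low_degree[OF P _ _ \<open>P W F\<close>])
  fix W F assume PW: "P W F" "W \<noteq> {}"
  note G = minor_closedD(1)[OF P PW(1)]
  show "\<exists>v\<in>W. card (nbrs F W v) \<le> 3"
  proof (cases "2 \<le> card W")
    case True
    then have "2 * card F < Suc 3 * card W" using K4_free_sparse[OF P K4 PW(1)] by simp
    then show ?thesis using obtain_low_degree[OF G PW(2)] by metis
  next
    case False
    then show ?thesis using PW(2) card_nbrs_less[OF G] by fastforce
  qed
qed (use K4 in simp)

text \<open>Fewer than 3 n edges force a vertex of degree at most 5, and a K6 would contain a
  K5.\<close>

lemma K5_free_five_colorable: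
  assumes P: "minor_closed P"
    and K5: "excludes_clique 5 P"
    and "P W F"
  shows "colorable 5 W F"
proof (rule colorable_if_low_degree[OF P _ _ \<open>P W F\<close>])
  fix W F assume PW: "P W F" "W \<noteq> {}"
  note G = minor_closedD(1)[OF P PW(1)]
  show "\<exists>v\<in>W. card (nbrs F W v) \<le> 5"
  proof (cases "3 \<le> card W")
    case True
    then have "2 * card F < Suc 5 * card W" using K5_free_sparse[OF P K5 PW(1)] by simp
    then show ?thesis using obtain_low_degree[OF G PW(2)] by metis
  next
    case False
    then show ?thesis using PW(2) card_nbrs_less[OF G] by fastforce
  qed
next
  show "excludes_clique (Suc 5) P" unfolding excludes_clique_def
  proof (intro allI impI notI)
    fix W F Q assume PW: "P W F" "Q \<subseteq> W" "clique F Q" "card Q = Suc 5"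
    then obtain R where "R \<subseteq> Q" "card R = 5" using obtain_subset_card[of 5 Q] by auto
    then show False using excludes_cliqueD[OF K5 PW(1), of R] PW by (auto simp: clique_def)
  qed
qed

subsection \<open>Minors of a graph\<close>

text \<open>Connectedness of the subgraph induced on \<open>B\<close>, phrased by cuts instead of
  walks.\<close>

definition linked :: "'a set set \<Rightarrow> 'a set \<Rightarrow> bool" where
  "linked E B \<longleftrightarrow> B \<noteq> {} \<and> (\<forall>A. A \<subseteq> B \<longrightarrow> A \<noteq> {} \<longrightarrow> A \<noteq> B \<longrightarrow> (\<exists>x\<in>A. \<exists>y\<in>B - A. {x, y} \<in> E))"

text \<open>A minor model: \<open>\<beta> w\<close> is the branch set of \<open>w\<close>.\<close>

definition is_minor :: "'a set \<Rightarrow> 'a set set \<Rightarrow> 'a set \<Rightarrow> 'a set set \<Rightarrow> bool" where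
  "is_minor V E W F \<longleftrightarrow> simple_graph W F \<and>
     (\<exists>\<beta>. (\<forall>w\<in>W. linked E (\<beta> w) \<and> \<beta> w \<subseteq> V) \<and>
          (\<forall>u\<in>W. \<forall>w\<in>W. u \<noteq> w \<longrightarrow> \<beta> u \<inter> \<beta> w = {}) \<and>
          (\<forall>u w. {u, w} \<in> F \<longrightarrow> (\<exists>x\<in>\<beta> u. \<exists>y\<in>\<beta> w. {x, y} \<in> E)))"

lemma linkedD:
  assumes "linked E B" "a \<in> A" "a \<in> B" "b \<in> B" "b \<notin> A"
  shows "\<exists>x\<in>B \<inter> A. \<exists>y\<in>B - A. {x, y} \<in> E"
proof -
  have "\<exists>x\<in>B \<inter> A. \<exists>y\<in>B - (B \<inter> A). {x, y} \<in> E"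
    using assms unfolding linked_def by (elim conjE allE[of _ "B \<inter> A"]) blast
  then show ?thesis by blast
qed

text \<open>A cut of \<open>B \<union> C\<close> splits \<open>B\<close> or \<open>C\<close>, or
  separates one from the other and is then crossed by \<open>{x, y}\<close>.\<close>

lemma linked_Un:
  assumes B: "linked E B" and C: "linked E C" and xy: "x \<in> B" "y \<in> C" "{x, y} \<in> E"
  shows "linked E (B \<union> C)"
  unfolding linked_def
proof (intro conjI allI impI)
  show "B \<union> C \<noteq> {}" using xy by blast
  fix A assume A: "A \<subseteq> B \<union> C" "A \<noteq> {}" "A \<noteq> B \<union> C"
  show "\<exists>x\<in>A. \<exists>y\<in>B \<union> C - A. {x, y} \<in> E"
  proof (cases "\<exists>S\<in>{B, C}. \<exists>a\<in>S. \<exists>b\<in>S. a \<in> A \<and> b \<notin> A")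
    case True
    then obtain S a b where S: "S \<in> {B, C}" "a \<in> S" "b \<in> S" "a \<in> A" "b \<notin> A" by blast
    then have "linked E S" using B C by blast
    then show ?thesis using linkedD[of E S a A b] S by blast
  next
    case False
    then have cut: "B \<subseteq> A \<or> B \<inter> A = {}" "C \<subseteq> A \<or> C \<inter> A = {}" by blast+
    have "{y, x} \<in> E" using xy(3) by (simp add: insert_commute)
    show ?thesis
    proof (cases "B \<subseteq> A")
      case True
      then have "C \<inter> A = {}" using cut(2) A by blast
      then have "x \<in> A" "y \<in> B \<union> C - A" using True xy by blast+
      then show ?thesis using xy(3) by blast
    next
      case no: False
      then have "B \<inter> A = {}" using cut(1) by blast
      then have "C \<subseteq> A" using cut(2) A by blast
      then have "y \<in> A" "x \<in> B \<union> C - A" using \<open>B \<inter> A = {}\<close> xy by blast+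
      then show ?thesis using \<open>{y, x} \<in> E\<close> by blast
    qed
  qed
qed

lemma is_minorI:
  assumes "simple_graph W F" "\<And>w. w \<in> W \<Longrightarrow> linked E (\<beta> w) \<and> \<beta> w \<subseteq> V"
    "\<And>u w. u \<in> W \<Longrightarrow> w \<in> W \<Longrightarrow> u \<noteq> w \<Longrightarrow> \<beta> u \<inter> \<beta> w = {}"
    "\<And>u w. {u, w} \<in> F \<Longrightarrow> \<exists>a\<in>\<beta> u. \<exists>b\<in>\<beta> w. {a, b} \<in> E"
  shows "is_minor V E W F"
  unfolding is_minor_def using assms by (intro conjI exI[of _ \<beta>]) auto

lemma is_minorE:
  assumes "is_minor V E W F"
  obtains \<beta> where "simple_graph W F" "\<And>w. w \<in> W \<Longrightarrow> linked E (\<beta> w) \<and> \<beta> w \<subseteq> V"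
    "\<And>u w. u \<in> W \<Longrightarrow> w \<in> W \<Longrightarrow> u \<noteq> w \<Longrightarrow> \<beta> u \<inter> \<beta> w = {}"
    "\<And>u w. {u, w} \<in> F \<Longrightarrow> \<exists>a\<in>\<beta> u. \<exists>b\<in>\<beta> w. {a, b} \<in> E"
  using assms unfolding is_minor_def by metis

lemma is_minor_refl:
  assumes "simple_graph V E"
  shows "is_minor V E V E"
proof -
  have "linked E {v}" for v by (auto simp: linked_def)
  then show ?thesis using assms by (intro is_minorI[where \<beta> = "\<lambda>v. {v}"]) auto
qed

lemma simple_graph_subset: "simple_graph W F \<Longrightarrow> F' \<subseteq> F \<Longrightarrow> simple_graph W F'"
  by (auto simp: simple_graph_def)

lemma simple_graph_edges_in: "simple_graph W F \<Longrightarrow> W' \<subseteq> W \<Longrightarrow> simple_graph W' (edges_in F W')"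
  by (auto simp: simple_graph_def edges_in_def intro: finite_subset)

lemma simple_graph_contract:
  assumes "simple_graph W F" "{x, y} \<in> F"
  shows "simple_graph (W - {y}) (contract F x y)"
proof -
  have "x \<noteq> y" "x \<in> W" using edge_in[OF assms] edge_neq[OF assms] by auto
  moreover have "v \<noteq> y" "v \<in> W" if "{y, v} \<in> F" for v
    using edge_in[OF assms(1) that] edge_neq[OF assms(1) that] by auto
  ultimately show ?thesis using assms(1) by (fastforce simp: simple_graph_def contract_def)
qed

text \<open>Deletions keep the branch sets; contracting \<open>{x, y}\<close> merges that of
  \<open>y\<close> into that of \<open>x\<close>, which stays connected by
  \<open>linked_Un\<close>.\<close>

lemma minor_closed_is_minor: "minor_closed (is_minor V E)"
  unfolding minor_closed_def
proof (intro conjI allI impI)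
  fix W F assume "is_minor V E W F"
  then show "simple_graph W F" by (simp add: is_minor_def)
next
  fix W F F' assume *: "is_minor V E W F" "F' \<subseteq> F"
  from *(1) show "is_minor V E W F'"
  proof (rule is_minorE)
    fix \<beta> assume \<beta>: "simple_graph W F" "\<And>w. w \<in> W \<Longrightarrow> linked E (\<beta> w) \<and> \<beta> w \<subseteq> V"
      "\<And>u w. u \<in> W \<Longrightarrow> w \<in> W \<Longrightarrow> u \<noteq> w \<Longrightarrow> \<beta> u \<inter> \<beta> w = {}"
      "\<And>u w. {u, w} \<in> F \<Longrightarrow> \<exists>a\<in>\<beta> u. \<exists>b\<in>\<beta> w. {a, b} \<in> E"
    show ?thesis
      by (rule is_minorI[OF simple_graph_subset[OF \<beta>(1) *(2)] \<beta>(2,3) \<beta>(4)]) (use *(2) in auto)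
  qed
next
  fix W F w assume "is_minor V E W F"
  then show "is_minor V E (W - {w}) (edges_in F (W - {w}))"
  proof (rule is_minorE)
    fix \<beta> assume \<beta>: "simple_graph W F" "\<And>w. w \<in> W \<Longrightarrow> linked E (\<beta> w) \<and> \<beta> w \<subseteq> V"
      "\<And>u w. u \<in> W \<Longrightarrow> w \<in> W \<Longrightarrow> u \<noteq> w \<Longrightarrow> \<beta> u \<inter> \<beta> w = {}"
      "\<And>u w. {u, w} \<in> F \<Longrightarrow> \<exists>a\<in>\<beta> u. \<exists>b\<in>\<beta> w. {a, b} \<in> E"
    have "simple_graph (W - {w}) (edges_in F (W - {w}))"
      using \<beta>(1) by (rule simple_graph_edges_in) blast
    then show ?thesis
      by (rule is_minorI[OF _ \<beta>(2,3) \<beta>(4)]) (auto simp: edges_in_def)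
  qed
next
  fix W F x y assume *: "is_minor V E W F" and xy: "{x, y} \<in> F"
  from *(1) obtain \<beta> where G: "simple_graph W F"
    and \<beta>: "\<And>w. w \<in> W \<Longrightarrow> linked E (\<beta> w) \<and> \<beta> w \<subseteq> V"
    "\<And>u w. u \<in> W \<Longrightarrow> w \<in> W \<Longrightarrow> u \<noteq> w \<Longrightarrow> \<beta> u \<inter> \<beta> w = {}"
    "\<And>u w. {u, w} \<in> F \<Longrightarrow> \<exists>a\<in>\<beta> u. \<exists>b\<in>\<beta> w. {a, b} \<in> E"
    by (rule is_minorE) blast
  have W: "x \<in> W" "y \<in> W" "x \<noteq> y" using edge_in[OF G xy] edge_neq[OF G xy] by auto
  let ?\<beta> = "\<beta>(x := \<beta> x \<union> \<beta> y)"
  have LW: "linked E (\<beta> x)" "linked E (\<beta> y)" using \<beta>(1) W by simp_all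
  obtain a b where "a \<in> \<beta> x" "b \<in> \<beta> y" "{a, b} \<in> E" using \<beta>(3)[OF xy] by blast
  then have "linked E (\<beta> x \<union> \<beta> y)" by (rule linked_Un[OF LW])
  then have 1: "linked E (?\<beta> w) \<and> ?\<beta> w \<subseteq> V" if "w \<in> W - {y}" for w
    using \<beta>(1) W that by auto
  have 2: "?\<beta> u \<inter> ?\<beta> w = {}" if "u \<in> W - {y}" "w \<in> W - {y}" "u \<noteq> w" for u w
    using \<beta>(2)[of u w] \<beta>(2)[of u y] \<beta>(2)[of w y] that W by auto
  have sub: "\<beta> w \<subseteq> ?\<beta> w" for w by auto
  have 3: "\<exists>a\<in>?\<beta> u. \<exists>b\<in>?\<beta> w. {a, b} \<in> E" if "{u, w} \<in> contract F x y" for u w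
  proof -
    have "{u, w} \<in> F \<or> (\<exists>v. {u, w} = {x, v} \<and> {y, v} \<in> F)" using that by (auto simp: contract_def)
    then show ?thesis
    proof
      assume "{u, w} \<in> F"
      then show ?thesis using \<beta>(3)[of u w] sub by blast
    next
      assume "\<exists>v. {u, w} = {x, v} \<and> {y, v} \<in> F"
      then obtain v where v: "{u, w} = {x, v}" "{y, v} \<in> F" by blast
      then obtain a b where ab: "a \<in> \<beta> y" "b \<in> \<beta> v" "{a, b} \<in> E" using \<beta>(3) by blast
      have "a \<in> ?\<beta> x" "b \<in> ?\<beta> v" "{b, a} \<in> E" using ab sub by (auto simp: insert_commute)
      moreover have "u = x \<and> w = v \<or> u = v \<and> w = x" using v(1) by (auto simp: doubleton_eq_iff)
      ultimately show ?thesis using ab(3) by blast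
    qed
  qed
  show "is_minor V E (W - {y}) (contract F x y)"
    using simple_graph_contract[OF G xy] 1 2 3 by (rule is_minorI)
qed

text \<open>Branch sets are numbered to match the indexed points of the topological theorem; the
  paths between those points will run through the connected unions of two of them.\<close>

lemma obtain_clique_model:
  assumes "is_minor V E W F" "Q \<subseteq> W" "clique F Q" "card Q = t"
  obtains \<beta> :: "nat \<Rightarrow> 'a set" where "\<And>i. i < t \<Longrightarrow> linked E (\<beta> i) \<and> \<beta> i \<subseteq> V"
    "\<And>i j. i < t \<Longrightarrow> j < t \<Longrightarrow> i \<noteq> j \<Longrightarrow> \<beta> i \<inter> \<beta> j = {}"
    "\<And>i j. i < t \<Longrightarrow> j < t \<Longrightarrow> i \<noteq> j \<Longrightarrow> linked E (\<beta> i \<union> \<beta> j)"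
proof -
  from assms(1) obtain \<beta> where G: "simple_graph W F"
    and \<beta>: "\<And>w. w \<in> W \<Longrightarrow> linked E (\<beta> w) \<and> \<beta> w \<subseteq> V"
    "\<And>u w. u \<in> W \<Longrightarrow> w \<in> W \<Longrightarrow> u \<noteq> w \<Longrightarrow> \<beta> u \<inter> \<beta> w = {}"
    "\<And>u w. {u, w} \<in> F \<Longrightarrow> \<exists>a\<in>\<beta> u. \<exists>b\<in>\<beta> w. {a, b} \<in> E"
    by (rule is_minorE) blast
  have "finite Q" using G assms(2) finite_subset by (auto simp: simple_graph_def)
  then obtain h where h: "bij_betw h {0..<t} Q" using ex_bij_betw_nat_finite assms(4) by blast
  have hQ: "h i \<in> Q" "h i \<in> W" if "i < t" for i using h that assms(2) by (auto simp: bij_betw_def)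
  have hne: "h i \<noteq> h j" if "i < t" "j < t" "i \<noteq> j" for i j
    using h that by (auto simp: bij_betw_def inj_on_def)
  have "linked E (\<beta> (h i) \<union> \<beta> (h j))" if "i < t" "j < t" "i \<noteq> j" for i j
  proof -
    have "{h i, h j} \<in> F" using assms(3) hQ hne that by (simp add: clique_def)
    then obtain a b where "a \<in> \<beta> (h i)" "b \<in> \<beta> (h j)" "{a, b} \<in> E" using \<beta>(3) by blast
    moreover have "linked E (\<beta> (h i))" "linked E (\<beta> (h j))" using \<beta>(1) hQ that by simp_all
    ultimately show ?thesis using linked_Un by metis
  qed
  then show ?thesis using that[of "\<beta> \<circ> h"] \<beta>(1,2) hQ hne by simp
qed

subsection \<open>Five points joined by ten paths\<close>

text \<open>The change of a continuous logarithm of \<open>\<gamma> t - z\<close> along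
  \<open>\<gamma>\<close>; for a closed path, \<open>2 * pi * \<i>\<close> times the winding number
  around \<open>z\<close>. It is a relation because no such logarithm exists if
  \<open>\<gamma>\<close> meets \<open>z\<close>.\<close>

definition log_change :: "(real \<Rightarrow> complex) \<Rightarrow> complex \<Rightarrow> complex \<Rightarrow> bool" where
  "log_change \<gamma> z d \<longleftrightarrow>
     (\<exists>q. continuous_on {0..1} q \<and> (\<forall>t\<in>{0..1}. \<gamma> t - z = exp (q t)) \<and> d = q 1 - q 0)"

text \<open>Two continuous logarithms of one function differ by a continuous function whose distinct
  values are at least \<open>2 * pi\<close> apart, hence by a constant.\<close>

lemma log_change_unique:
  assumes "log_change \<gamma> z d" "log_change \<gamma> z e"
  shows "d = e"
proof -
  obtain p q where p: "continuous_on {0..1} p" "\<And>t. t \<in> {0..1} \<Longrightarrow> \<gamma> t - z = exp (p t)" "d = p 1 - p 0"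
    and q: "continuous_on {0..1} q" "\<And>t. t \<in> {0..1} \<Longrightarrow> \<gamma> t - z = exp (q t)" "e = q 1 - q 0"
    using assms unfolding log_change_def by metis
  have "(\<lambda>t. p t - q t) constant_on {0..1::real}"
  proof (rule continuous_discrete_range_constant)
    fix s :: real assume s: "s \<in> {0..1}"
    have "2 * pi \<le> cmod ((p t - q t) - (p s - q s))"
      if "t \<in> {0..1}" "p t - q t \<noteq> p s - q s" for t
    proof -
      have "exp (p t) = exp (q t)" "exp (p s) = exp (q s)" using p q s that by metis+
      then have "exp (p t - q t) = exp (p s - q s)" by (simp add: exp_diff)
      then obtain n :: int where n: "p t - q t = p s - q s + (of_int (2 * n) * pi) * \<i>"
        using exp_eq by blast
      have "n \<noteq> 0" using n that(2) by auto
      then have "1 \<le> \<bar>real_of_int n\<bar>" by linarith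
      then show ?thesis using n by (simp add: norm_mult)
    qed
    then show "\<exists>e>0. \<forall>t. t \<in> {0..1} \<and> p t - q t \<noteq> p s - q s \<longrightarrow> e \<le> cmod (p t - q t - (p s - q s))"
      by (intro exI[of _ "2 * pi"]) auto
  qed (use p q in \<open>auto intro: continuous_intros\<close>)
  then obtain k where "\<And>t. t \<in> {0..1::real} \<Longrightarrow> p t - q t = k" by (auto simp: constant_on_def)
  then have "p 1 - q 1 = p 0 - q 0" by simp
  then show ?thesis unfolding p(3) q(3) by algebra
qed

lemma log_change_exp:
  assumes "log_change \<gamma> z d"
  shows "exp d * (\<gamma> 0 - z) = \<gamma> 1 - z"
  using assms by (auto simp: log_change_def exp_diff)

text \<open>Both sides are the change of a logarithm of \<open>\<gamma> s - \<delta> t\<close> between opposite corners of the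
  unit square.\<close>

lemma log_change_square:
  assumes "path \<gamma>" "path \<delta>" "path_image \<gamma> \<inter> path_image \<delta> = {}"
  obtains u v x y where "log_change \<gamma> (\<delta> 0) u" "log_change \<delta> (\<gamma> 1) v"
    "log_change \<delta> (\<gamma> 0) x" "log_change \<gamma> (\<delta> 1) y" "u + v = x + y"
proof -
  let ?S = "{0..1} \<times> {0..1} :: (real \<times> real) set"
  have cont: "continuous_on {0..1} \<gamma>" "continuous_on {0..1} \<delta>"
    using assms(1,2) by (simp_all add: path_def)
  have "continuous_on ?S (\<lambda>z. \<gamma> (fst z) - \<delta> (snd z))"
    by (rule continuous_on_diff; rule continuous_on_compose2[OF cont(1)] continuous_on_compose2[OF cont(2)])
       (auto intro: continuous_on_fst continuous_on_snd continuous_on_id)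
  moreover have "contractible ?S" by (intro convex_imp_contractible convex_Times) auto
  moreover have "\<gamma> (fst z) - \<delta> (snd z) \<noteq> 0" if "z \<in> ?S" for z
    using that assms(3) by (auto simp: path_image_def)
  ultimately obtain g where g: "continuous_on ?S g" "\<And>z. z \<in> ?S \<Longrightarrow> \<gamma> (fst z) - \<delta> (snd z) = exp (g z)"
    using continuous_logarithm_on_contractible by blast
  have g_exp: "exp (g (s, t)) = \<gamma> s - \<delta> t" if "s \<in> {0..1}" "t \<in> {0..1}" for s t
    using g(2)[of "(s, t)"] that by simp
  have row: "log_change \<gamma> (\<delta> t) (g (1, t) - g (0, t))" if "t \<in> {0..1}" for t
    unfolding log_change_def using that g_exp
    by (intro exI[of _ "\<lambda>s. g (s, t)"] conjI continuous_on_compose2[OF g(1)] continuous_intros) auto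
  \<comment> \<open>The summand \<open>\<i> * pi\<close> corrects the sign:
    \<open>\<delta> t - \<gamma> s = - exp (g (s, t))\<close>.\<close>
  have col: "log_change \<delta> (\<gamma> s) (g (s, 1) - g (s, 0))" if "s \<in> {0..1}" for s
    unfolding log_change_def using that g_exp
    by (intro exI[of _ "\<lambda>t. g (s, t) + \<i> * pi"] conjI continuous_on_compose2[OF g(1)] continuous_intros)
       (auto simp: exp_add)
  show ?thesis
    by (rule that[OF row[of 0] col[of 1] col[of 0] row[of 1]]) auto
qed

text \<open>An analytic form of the theorem that the complete graph on five vertices is not planar. A
  logarithm of \<open>c j - c k\<close> is chosen for \<open>j < k\<close>, and \<open>\<pi> \<i>\<close> is added to it for \<open>c k - c j\<close>. Relative
  to these, the logarithm of \<open>\<sigma> i j t - c k\<close> changes by an integer \<open>N i j k\<close> of full turns. Every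
  pair of disjoint paths gives a linear relation between these integers, and the sum of the fifteen
  relations fails modulo two.\<close>

theorem no_disjoint_paths_five:
  fixes c :: "nat \<Rightarrow> complex" and \<sigma> :: "nat \<Rightarrow> nat \<Rightarrow> real \<Rightarrow> complex"
  assumes path: "\<And>i j. i < j \<Longrightarrow> j < 5 \<Longrightarrow> path (\<sigma> i j)"
    and ends: "\<And>i j. i < j \<Longrightarrow> j < 5 \<Longrightarrow> \<sigma> i j 0 = c i \<and> \<sigma> i j 1 = c j"
    and disj: "\<And>i j k l. i < j \<Longrightarrow> j < 5 \<Longrightarrow> k < l \<Longrightarrow> l < 5 \<Longrightarrow> {i, j} \<inter> {k, l} = {} \<Longrightarrow>
      path_image (\<sigma> i j) \<inter> path_image (\<sigma> k l) = {}"
  shows False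
proof -
  define a where "a i j = (if i < j then Ln (c i - c j) else Ln (c j - c i) + \<i> * pi)" for i j
  have rel: "\<exists>u v x y. log_change (\<sigma> i j) (c k) u \<and> log_change (\<sigma> k l) (c j) v \<and>
      log_change (\<sigma> k l) (c i) x \<and> log_change (\<sigma> i j) (c l) y \<and> u + v = x + y"
    if "i < j" "j < 5" "k < l" "l < 5" "{i, j} \<inter> {k, l} = {}" for i j k l
    using log_change_square[OF path[OF that(1,2)] path[OF that(3,4)] disj[OF that]]
      ends[OF that(1,2)] ends[OF that(3,4)] by metis
  have turns: "\<exists>n :: int. d = a j k - a i k + 2 * of_int n * of_real pi * \<i>"
    if lc: "log_change (\<sigma> i j) (c k) d" and ij: "i < j" "j < 5" and k: "k \<noteq> i" "k \<noteq> j" for i j k d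
  proof -
    obtain q where q: "\<And>t. t \<in> {0..1} \<Longrightarrow> \<sigma> i j t - c k = exp (q t)"
      using lc unfolding log_change_def by blast
    have ne: "c i \<noteq> c k" "c j \<noteq> c k" using q[of 0] q[of 1] ends[OF ij] by auto
    have exp_a: "exp (a x k) = c x - c k" if "c x \<noteq> c k" for x
      using that by (simp add: a_def exp_add)
    have "exp d * (c i - c k) = c j - c k" using log_change_exp[OF lc] ends[OF ij] by simp
    then have "exp d = exp (a j k - a i k)" using ne by (simp add: exp_diff exp_a field_simps)
    then show ?thesis unfolding exp_eq by (auto simp: algebra_simps)
  qed
  define N where "N i j k = (SOME n :: int. log_change (\<sigma> i j) (c k) (a j k - a i k + 2 * of_int n * of_real pi * \<i>))" for i j k
  have N: "d = a j k - a i k + 2 * of_int (N i j k) * of_real pi * \<i>"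
    if "log_change (\<sigma> i j) (c k) d" "i < j" "j < 5" "k \<noteq> i" "k \<noteq> j" for i j k d
  proof -
    have "\<exists>n :: int. log_change (\<sigma> i j) (c k) (a j k - a i k + 2 * of_int n * of_real pi * \<i>)"
      using turns[OF that] that(1) by auto
    then have "log_change (\<sigma> i j) (c k) (a j k - a i k + 2 * of_int (N i j k) * of_real pi * \<i>)"
      unfolding N_def by (rule someI_ex)
    then show ?thesis by (rule log_change_unique[OF that(1)])
  qed
  have eq: "a j k - a i k + (a l j - a k j) - (a l i - a k i) - (a j l - a i l)
      = 2 * of_int (N k l i + N i j l - N i j k - N k l j) * of_real pi * \<i>"
    if ij: "i < j" "j < 5" and kl: "k < l" "l < 5" and ijkl: "{i, j} \<inter> {k, l} = {}" for i j k l
  proof -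
    obtain u v x y where uv: "log_change (\<sigma> i j) (c k) u" "log_change (\<sigma> k l) (c j) v"
      "log_change (\<sigma> k l) (c i) x" "log_change (\<sigma> i j) (c l) y" "u + v = x + y"
      using rel[OF ij kl ijkl] by blast
    have ne: "k \<noteq> i" "k \<noteq> j" "l \<noteq> i" "l \<noteq> j" using ijkl by auto
    have "u - a j k + a i k + (v - a l j + a k j) = x - a l i + a k i + (y - a j l + a i l)
        - (a j k - a i k + (a l j - a k j) - (a l i - a k i) - (a j l - a i l))"
      using uv(5) by algebra
    then show ?thesis
      unfolding N[OF uv(1) ij ne(1,2)] N[OF uv(2) kl ne(2,4)[symmetric]] N[OF uv(3) kl ne(1,3)[symmetric]] N[OF uv(4) ij ne(3,4)]
      by (simp add: algebra_simps)
  qed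
  have int_eq: "m = n" if "2 * of_int m * of_real pi * \<i> = (2 * of_int n * of_real pi * \<i> :: complex)" for m n :: int
    using that by simp
  have type1: "N p q r + N r s q = N r s p + N p q s" if "p < q" "q < r" "r < s" "s < 5" for p q r s
  proof -
    have "2 * of_int (N r s p + N p q s - N p q r - N r s q) * of_real pi * \<i> = (2 * of_int 0 * of_real pi * \<i> :: complex)"
      using eq[of p q r s] that by (simp add: a_def)
    then show ?thesis by (drule_tac int_eq) simp
  qed
  \<comment> \<open>For interleaved pairs the half turns built into \<open>a\<close> do not cancel:
    three stand against one, which leaves one full turn. In \<open>type1\<close> and
    \<open>type3\<close> two stand against two.\<close>
  have type2: "N p r q + N q s r + 1 = N q s p + N p r s" if "p < q" "q < r" "r < s" "s < 5" for p q r s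
  proof -
    have "2 * of_int (N q s p + N p r s - N p r q - N q s r) * of_real pi * \<i> = (2 * of_int 1 * of_real pi * \<i> :: complex)"
      using eq[of p r q s] that by (simp add: a_def)
    then show ?thesis by (drule_tac int_eq) simp
  qed
  have type3: "N p s q + N q r s = N q r p + N p s r" if "p < q" "q < r" "r < s" "s < 5" for p q r s
  proof -
    have "2 * of_int (N q r p + N p s r - N p s q - N q r s) * of_real pi * \<i> = (2 * of_int 0 * of_real pi * \<i> :: complex)"
      using eq[of p s q r] that by (simp add: a_def)
    then show ?thesis by (drule_tac int_eq) simp
  qed
  define W where "W p q r s = (\<Sum>(i, j, k)\<leftarrow>[(p, q, r), (r, s, q), (r, s, p), (p, q, s), (p, r, q), (q, s, r),
      (q, s, p), (p, r, s), (p, s, q), (q, r, s), (q, r, p), (p, s, r)]. N i j k)" for p q r s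
  have odd_W: "odd (W p q r s)" if "p < q" "q < r" "r < s" "s < 5" for p q r s
  proof -
    have "W p q r s = 2 * (N r s p + N p q s + N q s p + N p r s + N q r p + N p s r) - 1"
      using type1[OF that] type2[OF that] type3[OF that] by (simp add: W_def)
    then show ?thesis by simp
  qed
  have "odd (W 0 1 2 3 + W 0 1 2 4 + W 0 1 3 4 + W 0 2 3 4 + W 1 2 3 4)"
    using odd_W[of 0 1 2 3] odd_W[of 0 1 2 4] odd_W[of 0 1 3 4] odd_W[of 0 2 3 4] odd_W[of 1 2 3 4]
    by simp
  \<comment> \<open>Each \<open>N i j k\<close> occurs in exactly the two sums whose four indices
    include \<open>i\<close>, \<open>j\<close> and \<open>k\<close>, so the total is even.\<close>
  moreover have "W 0 1 2 3 + W 0 1 2 4 + W 0 1 3 4 + W 0 2 3 4 + W 1 2 3 4 =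
      2 * (\<Sum>(i, j, k)\<leftarrow>[(0, 1, 2), (0, 1, 3), (0, 1, 4), (0, 2, 1), (0, 2, 3), (0, 2, 4),
        (0, 3, 1), (0, 3, 2), (0, 3, 4), (0, 4, 1), (0, 4, 2), (0, 4, 3), (1, 2, 0), (1, 2, 3), (1, 2, 4),
        (1, 3, 0), (1, 3, 2), (1, 3, 4), (1, 4, 0), (1, 4, 2), (1, 4, 3), (2, 3, 0), (2, 3, 1), (2, 3, 4),
        (2, 4, 0), (2, 4, 1), (2, 4, 3), (3, 4, 0), (3, 4, 1), (3, 4, 2)]. N i j k)"
    by (simp add: W_def)
  ultimately show False by (metis dvd_triv_left)
qed

subsection \<open>Drawings and minors\<close>

abbreviation drawn :: "'a set set \<Rightarrow> ('a \<Rightarrow> complex) \<Rightarrow> ('a set \<Rightarrow> real \<Rightarrow> complex) \<Rightarrow> 'a set \<Rightarrow> complex set" where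
  "drawn E p \<gamma> S \<equiv> drawing_image S (edges_in E S) p \<gamma>"

lemma drawn_mono: "S \<subseteq> T \<Longrightarrow> drawn E p \<gamma> S \<subseteq> drawn E p \<gamma> T"
  by (fastforce simp: drawing_image_def edges_in_def)

lemma plane_drawing_edge:
  assumes "plane_drawing V E p \<gamma>" "e \<in> E"
  shows "arc (\<gamma> e)" "{pathstart (\<gamma> e), pathfinish (\<gamma> e)} = p ` e"
    "path_image (\<gamma> e) \<inter> p ` V = p ` e"
  using assms by (auto simp only: plane_drawing_def)

lemma drawn_disjoint:
  assumes G: "simple_graph V E" and D: "plane_drawing V E p \<gamma>"
    and ST: "S \<subseteq> V" "T \<subseteq> V" "S \<inter> T = {}"
  shows "drawn E p \<gamma> S \<inter> drawn E p \<gamma> T = {}"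
proof -
  have inj: "inj_on p V" using D by (simp add: plane_drawing_def)
  have pts: "p ` A \<inter> p ` B = {}" if "A \<subseteq> V" "B \<subseteq> V" "A \<inter> B = {}" for A B
    using inj_on_image_Int[OF inj that(1,2)] that(3) by simp
  have pt_arc: "p ` A \<inter> path_image (\<gamma> e) = {}"
    if "A \<subseteq> V" "B \<subseteq> V" "A \<inter> B = {}" "e \<in> edges_in E B" for A B e
  proof -
    have e: "e \<in> E" "e \<subseteq> B" using that(4) by (auto simp: edges_in_def)
    have "p ` A \<inter> path_image (\<gamma> e) \<subseteq> p ` A \<inter> p ` e"
      using plane_drawing_edge(3)[OF D e(1)] that(1) by blast
    also have "\<dots> = {}" using e that by (intro pts) auto
    finally show ?thesis by blast
  qed
  have arcs: "path_image (\<gamma> e) \<inter> path_image (\<gamma> f) = {}" if "e \<in> edges_in E S" "f \<in> edges_in E T" for e f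
  proof -
    have ef: "e \<in> E" "f \<in> E" "e \<inter> f = {}" using that ST(3) by (auto simp: edges_in_def)
    have "e \<noteq> {}" using G ef(1) by (force simp: simple_graph_def)
    then have "e \<noteq> f" using ef(3) by blast
    then have "path_image (\<gamma> e) \<inter> path_image (\<gamma> f) = p ` (e \<inter> f)"
      using D ef(1,2) unfolding plane_drawing_def by blast
    then show ?thesis using ef(3) by simp
  qed
  have TS: "T \<inter> S = {}" using ST(3) by blast
  show ?thesis
  proof (rule equals0I)
    fix z assume z: "z \<in> drawn E p \<gamma> S \<inter> drawn E p \<gamma> T"
    have cases: "z \<in> p ` A \<or> (\<exists>e\<in>edges_in E A. z \<in> path_image (\<gamma> e))" if "z \<in> drawn E p \<gamma> A" for A
      using that by (simp add: drawing_image_def)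
    have "z \<in> drawn E p \<gamma> S" "z \<in> drawn E p \<gamma> T" using z by simp_all
    from cases[OF this(1)] cases[OF this(2)] show False
      using pts[OF ST] pt_arc[OF ST] pt_arc[OF ST(2,1) TS] arcs
      by (elim disjE bexE; meson disjoint_iff)
  qed
qed

lemma compact_drawn:
  assumes G: "simple_graph V E" and D: "plane_drawing V E p \<gamma>" and "S \<subseteq> V"
  shows "compact (drawn E p \<gamma> S)"
proof -
  have "finite S" using G \<open>S \<subseteq> V\<close> finite_subset by (auto simp: simple_graph_def)
  moreover have "finite (edges_in E S)"
    using simple_graph_finite_E[OF G] by (simp add: edges_in_def)
  moreover have "compact (path_image (\<gamma> e))" if "e \<in> edges_in E S" for e
    using that plane_drawing_edge(1)[OF D] by (intro compact_arc_image) (simp add: edges_in_def)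
  ultimately show ?thesis
    by (auto simp: drawing_image_def intro!: compact_Un compact_UN intro: finite_imp_compact)
qed

text \<open>Let \<open>A\<close> be the vertices reachable from a root within the drawing. If
  \<open>A\<close> were a proper subset of \<open>B\<close>, an edge would leave it by
  \<open>linked\<close>, and its arc would reach a further vertex.\<close>

lemma path_connected_drawn:
  assumes G: "simple_graph V E" and D: "plane_drawing V E p \<gamma>"
    and B: "B \<subseteq> V" "linked E B"
  shows "path_connected (drawn E p \<gamma> B)"
proof -
  let ?R = "drawn E p \<gamma> B"
  have edge: "path_component ?R z (p u)" if "e \<in> edges_in E B" "z \<in> path_image (\<gamma> e)" "u \<in> e" for e z u
  proof -
    have e: "e \<in> E" using that(1) by (simp add: edges_in_def)
    have "path_image (\<gamma> e) \<subseteq> ?R" using that(1) by (auto simp: drawing_image_def)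
    moreover have "path_connected (path_image (\<gamma> e))"
      using plane_drawing_edge(1)[OF D e] by (intro path_connected_path_image arc_imp_path)
    moreover have "p u \<in> path_image (\<gamma> e)" using plane_drawing_edge(3)[OF D e] that(3) by blast
    ultimately show ?thesis
      using that(2) path_connected_component path_component_of_subset by metis
  qed
  obtain r where r: "r \<in> B" using B(2) by (auto simp: linked_def)
  define A where "A = {u\<in>B. path_component ?R (p u) (p r)}"
  have "r \<in> A" using r by (auto simp: A_def drawing_image_def intro: path_component_refl)
  have "A = B"
  proof (rule ccontr)
    assume "A \<noteq> B"
    moreover have "A \<subseteq> B" by (auto simp: A_def)
    ultimately obtain x y where xy: "x \<in> A" "y \<in> B - A" "{x, y} \<in> E"
      using B(2) \<open>r \<in> A\<close> unfolding linked_def by blast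
    then have e: "{x, y} \<in> edges_in E B" using \<open>A \<subseteq> B\<close> by (auto simp: edges_in_def)
    have "p y \<in> path_image (\<gamma> {x, y})" using plane_drawing_edge(3)[OF D xy(3)] by blast
    then have "path_component ?R (p y) (p x)" using edge[OF e] by blast
    moreover have "path_component ?R (p x) (p r)" using xy(1) by (simp add: A_def)
    ultimately have "path_component ?R (p y) (p r)" by (rule path_component_trans)
    then show False using xy(2) by (simp add: A_def)
  qed
  then have vert: "path_component ?R (p u) (p r)" if "u \<in> B" for u using that by (auto simp: A_def)
  have "path_component ?R z (p r)" if "z \<in> ?R" for z
  proof -
    from that consider u where "u \<in> B" "z = p u" | e where "e \<in> edges_in E B" "z \<in> path_image (\<gamma> e)"
      unfolding drawing_image_def by blast
    then show ?thesis
    proof cases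
      case 1
      then show ?thesis using vert by simp
    next
      case (2 e)
      have "e \<noteq> {}" "e \<subseteq> B" using G 2(1) by (auto simp: simple_graph_def edges_in_def)
      then obtain u where u: "u \<in> e" "u \<in> B" by blast
      show ?thesis using edge[OF 2 u(1)] vert[OF u(2)] by (rule path_component_trans)
    qed
  qed
  then show ?thesis
    unfolding path_connected_component by (meson path_component_sym path_component_trans)
qed

lemma obtain_drawn_path:
  assumes "simple_graph V E" "plane_drawing V E p \<gamma>" "B \<subseteq> V" "linked E B" "u \<in> B" "v \<in> B"
  obtains g where "path g" "path_image g \<subseteq> drawn E p \<gamma> B" "g 0 = p u" "g 1 = p v"
proof -
  have "p u \<in> drawn E p \<gamma> B" "p v \<in> drawn E p \<gamma> B" using assms(5,6) by (auto simp: drawing_image_def)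
  then show ?thesis
    using that path_connected_drawn[OF assms(1-4)] unfolding path_connected_def pathstart_def pathfinish_def
    by metis
qed

text \<open>Points \<open>i\<close> and \<open>j\<close> are joined inside the drawing of
  \<open>\<beta> i \<union> \<beta> j\<close>. Paths with a common index may meet; four different
  indices give disjoint vertex sets, hence disjoint drawings.\<close>

theorem planar_excludes_K5:
  assumes G: "simple_graph V E" and "planar V E"
  shows "excludes_clique 5 (is_minor V E)"
  unfolding excludes_clique_def
proof (intro allI impI notI)
  fix W F Q assume Q: "is_minor V E W F" "Q \<subseteq> W" "clique F Q" "card Q = 5"
  obtain p \<gamma> where D: "plane_drawing V E p \<gamma>" using assms(2) by (auto simp: planar_def)
  obtain \<beta> :: "nat \<Rightarrow> 'a set" where \<beta>: "\<And>i. i < 5 \<Longrightarrow> linked E (\<beta> i) \<and> \<beta> i \<subseteq> V"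
    "\<And>i j. i < 5 \<Longrightarrow> j < 5 \<Longrightarrow> i \<noteq> j \<Longrightarrow> \<beta> i \<inter> \<beta> j = {}"
    "\<And>i j. i < 5 \<Longrightarrow> j < 5 \<Longrightarrow> i \<noteq> j \<Longrightarrow> linked E (\<beta> i \<union> \<beta> j)"
    using obtain_clique_model[OF Q] by blast
  define r where "r i = (SOME v. v \<in> \<beta> i)" for i
  have r: "r i \<in> \<beta> i" if "i < 5" for i
    using \<beta>(1)[OF that] unfolding r_def linked_def by (simp add: some_in_eq)
  have "\<exists>g. path g \<and> path_image g \<subseteq> drawn E p \<gamma> (\<beta> i \<union> \<beta> j) \<and> g 0 = p (r i) \<and> g 1 = p (r j)"
    if "i < j" "j < 5" for i j
  proof -
    have ij: "i < 5" "i \<noteq> j" using that by auto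
    have "\<beta> i \<union> \<beta> j \<subseteq> V" using \<beta>(1) ij that by simp
    then show ?thesis
      using obtain_drawn_path[OF G D _ \<beta>(3)[OF ij(1) that(2) ij(2)]] r[OF ij(1)] r[OF that(2)]
      by (metis UnI1 UnI2)
  qed
  then obtain \<sigma> where \<sigma>: "\<And>i j. i < j \<Longrightarrow> j < 5 \<Longrightarrow> path (\<sigma> i j) \<and>
      path_image (\<sigma> i j) \<subseteq> drawn E p \<gamma> (\<beta> i \<union> \<beta> j) \<and> \<sigma> i j 0 = p (r i) \<and> \<sigma> i j 1 = p (r j)"
    by metis
  show False
  proof (rule no_disjoint_paths_five[of \<sigma> "p \<circ> r"])
    fix i j k l :: nat assume ijkl: "i < j" "j < 5" "k < l" "l < 5" "{i, j} \<inter> {k, l} = {}"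
    have "(\<beta> i \<union> \<beta> j) \<inter> (\<beta> k \<union> \<beta> l) = {}"
      using \<beta>(2)[of i k] \<beta>(2)[of i l] \<beta>(2)[of j k] \<beta>(2)[of j l] ijkl by auto
    then have "drawn E p \<gamma> (\<beta> i \<union> \<beta> j) \<inter> drawn E p \<gamma> (\<beta> k \<union> \<beta> l) = {}"
      using \<beta>(1) ijkl by (intro drawn_disjoint[OF G D]) auto
    then show "path_image (\<sigma> i j) \<inter> path_image (\<sigma> k l) = {}"
      using \<sigma>[OF ijkl(1,2)] \<sigma>[OF ijkl(3,4)] by blast
  qed (use \<sigma> in auto)
qed

text \<open>Only \<open>K\<close> has to be avoided: a short segment from \<open>c\<close> to a
  nearby outside point may cross \<open>D\<close> but stays in a ball that misses \<open>K\<close>,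
  and the open connected outside leads on to \<open>z\<close>.\<close>

lemma obtain_path_to_outside:
  fixes D :: "complex set"
  assumes "compact D" "closed K" "K \<subseteq> D" "c \<in> frontier (outside D)" "c \<notin> K" "z \<in> outside D"
  obtains g where "path g" "g 0 = c" "g 1 = z" "path_image g \<inter> K = {}"
proof -
  obtain \<epsilon> where \<epsilon>: "\<epsilon> > 0" "ball c \<epsilon> \<subseteq> - K"
    using assms(2,5) by (metis ComplI open_Compl open_contains_ball)
  have "c \<in> closure (outside D)" using assms(4) by (simp add: frontier_def)
  then obtain w where w: "w \<in> outside D" "dist w c < \<epsilon>"
    using \<epsilon>(1) unfolding closure_approachable by blast
  have "open (outside D)" using assms(1) by (intro open_outside compact_imp_closed)
  moreover have "connected (outside D)" using assms(1) by (intro connected_outside compact_imp_bounded) simp_all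
  ultimately have "path_connected (outside D)" by (rule connected_open_path_connected)
  then obtain g where g: "path g" "path_image g \<subseteq> outside D" "pathstart g = w" "pathfinish g = z"
    using w(1) assms(6) unfolding path_connected_def by blast
  let ?h = "linepath c w +++ g"
  have "path_image (linepath c w) \<subseteq> ball c \<epsilon>"
    using w(2) \<epsilon>(1) by (simp add: closed_segment_subset dist_commute)
  moreover have "path_image ?h \<subseteq> path_image (linepath c w) \<union> path_image g" by (rule path_image_join_subset)
  moreover have "outside D \<inter> K = {}" using assms(3) outside_no_overlap by blast
  ultimately have "path_image ?h \<inter> K = {}" using \<epsilon>(2) g(2) by blast
  moreover have "?h 0 = c" "?h 1 = z"
    using g(4) by (simp_all add: joinpaths_def linepath_def pathfinish_def)
  ultimately show ?thesis using that[of ?h] g(1,3) by simp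
qed

text \<open>A path from branch set \<open>i\<close> to the outer point avoids the drawing of
  \<open>V - \<beta> i\<close>, which contains all paths between the other branch sets. Two paths to
  the outer point share the index 4 and may meet.\<close>

theorem outerplanar_excludes_K4:
  assumes G: "simple_graph V E" and "outerplanar V E"
  shows "excludes_clique 4 (is_minor V E)"
  unfolding excludes_clique_def
proof (intro allI impI notI)
  fix W F Q assume Q: "is_minor V E W F" "Q \<subseteq> W" "clique F Q" "card Q = 4"
  obtain p \<gamma> where D: "plane_drawing V E p \<gamma>"
    and out: "\<And>v. v \<in> V \<Longrightarrow> p v \<in> frontier (outside (drawing_image V E p \<gamma>))"
    using assms(2) by (auto simp: outerplanar_def)
  let ?D = "drawing_image V E p \<gamma>"
  have D_eq: "drawn E p \<gamma> V = ?D" using edges_in_V[OF G] by simp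
  obtain \<beta> :: "nat \<Rightarrow> 'a set" where \<beta>: "\<And>i. i < 4 \<Longrightarrow> linked E (\<beta> i) \<and> \<beta> i \<subseteq> V"
    "\<And>i j. i < 4 \<Longrightarrow> j < 4 \<Longrightarrow> i \<noteq> j \<Longrightarrow> \<beta> i \<inter> \<beta> j = {}"
    "\<And>i j. i < 4 \<Longrightarrow> j < 4 \<Longrightarrow> i \<noteq> j \<Longrightarrow> linked E (\<beta> i \<union> \<beta> j)"
    using obtain_clique_model[OF Q] by blast
  define r where "r i = (SOME v. v \<in> \<beta> i)" for i
  have r: "r i \<in> \<beta> i" "r i \<in> V" if "i < 4" for i
    using \<beta>(1)[OF that] some_in_eq[of "\<beta> i"] unfolding r_def linked_def by blast+
  have "outside ?D \<noteq> {}" using out[OF r(2)[of 0]] by auto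
  then obtain z where z: "z \<in> outside ?D" by blast
  define c where "c i = (if i < 4 then p (r i) else z)" for i :: nat
  \<comment> \<open>For \<open>j < 4\<close>, missing the complement means containment; this form
    lets one function \<open>\<sigma>\<close> choose both kinds of path.\<close>
  have "\<exists>g. path g \<and> g 0 = c i \<and> g 1 = c j \<and>
      path_image g \<inter> (if j < 4 then - drawn E p \<gamma> (\<beta> i \<union> \<beta> j) else drawn E p \<gamma> (V - \<beta> i)) = {}"
    if "i < j" "j < 5" for i j
  proof (cases "j < 4")
    case True
    then have ij: "i < 4" "i \<noteq> j" using that by auto
    have "\<beta> i \<union> \<beta> j \<subseteq> V" using \<beta>(1) ij True by simp
    then obtain g where "path g" "path_image g \<subseteq> drawn E p \<gamma> (\<beta> i \<union> \<beta> j)" "g 0 = p (r i)" "g 1 = p (r j)"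
      using obtain_drawn_path[OF G D _ \<beta>(3)[OF ij(1) True ij(2)]] r(1)[OF ij(1)] r(1)[OF True]
      by (metis UnI1 UnI2)
    then show ?thesis using True ij by (intro exI[of _ g]) (auto simp: c_def)
  next
    case False
    then have i: "i < 4" using that by auto
    have "drawn E p \<gamma> (\<beta> i) \<inter> drawn E p \<gamma> (V - \<beta> i) = {}"
      using \<beta>(1)[OF i] by (intro drawn_disjoint[OF G D]) auto
    moreover have "p (r i) \<in> drawn E p \<gamma> (\<beta> i)" using r(1)[OF i] by (auto simp: drawing_image_def)
    ultimately have "p (r i) \<notin> drawn E p \<gamma> (V - \<beta> i)" by blast
    moreover have "compact ?D" "compact (drawn E p \<gamma> (V - \<beta> i))"
      using compact_drawn[OF G D, of V] compact_drawn[OF G D, of "V - \<beta> i"] D_eq by auto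
    moreover have "drawn E p \<gamma> (V - \<beta> i) \<subseteq> ?D" using drawn_mono[of "V - \<beta> i" V E p \<gamma>] D_eq by auto
    ultimately obtain g where "path g" "g 0 = p (r i)" "g 1 = z" "path_image g \<inter> drawn E p \<gamma> (V - \<beta> i) = {}"
      using obtain_path_to_outside[OF _ compact_imp_closed _ out[OF r(2)[OF i]] _ z] by metis
    then show ?thesis using False i by (intro exI[of _ g]) (auto simp: c_def)
  qed
  then obtain \<sigma> where \<sigma>: "\<And>i j. i < j \<Longrightarrow> j < 5 \<Longrightarrow> path (\<sigma> i j) \<and> \<sigma> i j 0 = c i \<and> \<sigma> i j 1 = c j \<and>
      path_image (\<sigma> i j) \<inter> (if j < 4 then - drawn E p \<gamma> (\<beta> i \<union> \<beta> j) else drawn E p \<gamma> (V - \<beta> i)) = {}"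
    by metis
  have inner: "path_image (\<sigma> i j) \<subseteq> drawn E p \<gamma> (\<beta> i \<union> \<beta> j)" if "i < j" "j < 4" for i j
    using \<sigma>[of i j] that by auto
  have outer: "path_image (\<sigma> i 4) \<inter> drawn E p \<gamma> (V - \<beta> i) = {}" if "i < 4" for i
    using \<sigma>[of i 4] that by auto
  have outer_inner: "path_image (\<sigma> i 4) \<inter> path_image (\<sigma> k l) = {}"
    if "i < 4" "k < l" "l < 4" "i \<noteq> k" "i \<noteq> l" for i k l
  proof -
    have "\<beta> k \<union> \<beta> l \<subseteq> V - \<beta> i" using \<beta>(1)[of k] \<beta>(1)[of l] \<beta>(2)[of i k] \<beta>(2)[of i l] that by auto
    from drawn_mono[OF this] show ?thesis using inner[OF that(2,3)] outer[OF that(1)] by blast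
  qed
  show False
  proof (rule no_disjoint_paths_five[of \<sigma> c])
    fix i j k l :: nat assume ijkl: "i < j" "j < 5" "k < l" "l < 5" "{i, j} \<inter> {k, l} = {}"
    consider "j < 4" "l < 4" | "j = 4" "l < 4" | "j < 4" "l = 4"
      using ijkl by fastforce
    then show "path_image (\<sigma> i j) \<inter> path_image (\<sigma> k l) = {}"
    proof cases
      case 1
      have "(\<beta> i \<union> \<beta> j) \<inter> (\<beta> k \<union> \<beta> l) = {}"
        using \<beta>(2)[of i k] \<beta>(2)[of i l] \<beta>(2)[of j k] \<beta>(2)[of j l] ijkl 1 by auto
      then have "drawn E p \<gamma> (\<beta> i \<union> \<beta> j) \<inter> drawn E p \<gamma> (\<beta> k \<union> \<beta> l) = {}"
        using \<beta>(1) ijkl 1 by (intro drawn_disjoint[OF G D]) auto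
      then show ?thesis using inner[OF ijkl(1) 1(1)] inner[OF ijkl(3) 1(2)] by blast
    next
      case 2
      then show ?thesis using outer_inner[of i k l] ijkl by auto
    next
      case 3
      then show ?thesis using outer_inner[of k i j] ijkl by auto
    qed
  qed (use \<sigma> in auto)
qed

subsection \<open>Planar and outerplanar graphs\<close>

text \<open>Capped payments sum to 0 + 1 + 2 + 3 + 3 = 9, so 10 s \<le> 19 n + 5 m, and m \<le> 3 n
  turns this into 34 n.\<close>

lemma sum_color_cost_planar:
  assumes G: "simple_graph V E" and "planar V E"
  shows "5 * sum_color_cost V E \<le> 17 * card V"
proof -
  note P = minor_closed_is_minor[of V E]
  note K5 = planar_excludes_K5[OF assms]
  note refl = is_minor_refl[OF G]
  have "card Q \<le> Suc 3" if "Q \<subseteq> V" "\<And>u v. u \<in> Q \<Longrightarrow> v \<in> Q \<Longrightarrow> u \<noteq> v \<Longrightarrow> {u, v} \<in> E" for Q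
  proof (rule ccontr)
    assume "\<not> card Q \<le> Suc 3"
    then obtain R where R: "R \<subseteq> Q" "card R = 5" using obtain_subset_card[of 5 Q] by auto
    then have "R \<subseteq> V" "clique E R" using that unfolding clique_def by blast+
    then show False using excludes_cliqueD[OF K5 refl] R(2) by blast
  qed
  from sum_color_cost_le_rotated_pay[OF G K5_free_five_colorable[OF P K5 refl] this]
  have "5 * (2 * sum_color_cost V E) \<le> 5 * (2 * card V + card E) + 9 * card V"
    by (simp add: numeral_eq_Suc)
  moreover have "card E \<le> 3 * card V"
  proof (cases "3 \<le> card V")
    case True
    then show ?thesis using K5_free_sparse[OF P K5 refl] by simp
  next
    case False
    then have "card V * (card V - 1) \<le> card V * 2" by (intro mult_le_mono) auto
    then show ?thesis using card_edges_le[OF G] by linarith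
  qed
  ultimately show ?thesis by simp
qed

text \<open>With m \<le> 2 n, the bound 3 s \<le> 5 n + m becomes 7 n.\<close>

lemma sum_color_cost_outerplanar:
  assumes G: "simple_graph V E" and "outerplanar V E"
  shows "3 * sum_color_cost V E \<le> 7 * card V"
proof -
  note P = minor_closed_is_minor[of V E]
  note K4 = outerplanar_excludes_K4[OF assms]
  note refl = is_minor_refl[OF G]
  have "card E \<le> 2 * card V"
  proof (cases "2 \<le> card V")
    case True
    then show ?thesis using K4_free_sparse[OF P K4 refl] by simp
  next
    case False
    then have "card V * (card V - 1) \<le> card V * 2" by (intro mult_le_mono) auto
    then show ?thesis using card_edges_le[OF G] by linarith
  qed
  then show ?thesis
    using sum_color_cost_three_colorable[OF G K4_free_three_colorable[OF P K4 refl]] by simp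
qed

theorem theorem4:
  fixes V :: "'a set" and E :: "'a set set"
  assumes "simple_graph V E"
  shows "(colorable 4 V E \<longrightarrow>
            real (sum_color_cost V E) \<le> (8 * real (card V) + 3 * real (card E)) / 5) \<and>
         (planar V E \<longrightarrow> real (sum_color_cost V E) \<le> 17 / 5 * real (card V)) \<and>
         (outerplanar V E \<longrightarrow> real (sum_color_cost V E) \<le> 7 / 3 * real (card V))"
proof (intro conjI impI)
  assume "colorable 4 V E"
  from sum_color_cost_four_colorable[OF assms this]
  show "real (sum_color_cost V E) \<le> (8 * real (card V) + 3 * real (card E)) / 5" by simp
next
  assume "planar V E"
  from sum_color_cost_planar[OF assms this]
  show "real (sum_color_cost V E) \<le> 17 / 5 * real (card V)" by simp
next
  assume "outerplanar V E"
  from sum_color_cost_outerplanar[OF assms this]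
  show "real (sum_color_cost V E) \<le> 7 / 3 * real (card V)" by simp
qed

end
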